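(* If $X$ is a compact Poincar\'e space, then $\widetilde{X}$ is the traditional universal cover of $X$ (via $\phi:\widetilde{X}\to X$) and $\lambda:\pi_1(X)\to\delta_1(X)$ is an isomorphism.
   Context: A Poincar\'e space is a connected, locally pathwise connected, semilocally simply connected topological space; semilocally simply connected means each $x\in X$ is contained in an open set $U$ such that every loop in $U$ based at $x$ is null-homotopic in $X$. A compact (Hausdorff) space is given the unique uniformity compatible with its topology. The traditional universal cover is the simply connected covering space of classical covering space theory. All entourages are taken to be symmetric. Fix a basepoint $*\in X$. For an entourage $E$ of $X$, an $E$-chain from $p$ to $q$ is a finite sequence $\{x_0=p,\dots,x_n=q\}$ with $(x_i,x_{i+1})\in E$ for all $i$; it is an $E$-loop if $p=q$. Two $E$-chains with the same endpoints are $E$-homotopic if one is obtained from the other in finitely many steps, each adding or removing a single point, always keeping the endpoints fixed and keeping an $E$-chain at each stage (in particular $\{p\}$ and $\{p,p\}$ are $E$-homotopic); $[\alpha]_E$ is the class of $\alpha$. $X_E$ is the set of $E$-homotopy classes of $E$-chains starting at $*$. For an entourage $D\subset E$ let $D^*$ be the set of pairs $([*=x_0,\dots,x_n,y]_E,[*=x_0,\dots,x_n,z]_E)$ with $(y,z)\in D$; $X_E$ carries the uniformity with base $\{D^*:D\subset E\}$. For $F\subset E$, $\phi_{EF}:X_F\to X_E$ is $[\alpha]_F\mapsto[\alpha]_E$. $\widetilde{X}=\varprojlim X_E$ (over all entourages, ordered by reverse inclusion, with the inverse limit uniformity and basepoint $*=([*]_E)_E$), with projection $\phi:\widetilde{X}\to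 X=X_{X\times X}$. $\delta_E(X)$ is the group of $E$-homotopy classes of $E$-loops at $*$ under concatenation. $\delta_1(X)=\varprojlim\delta_E(X)$ (bonding maps $[\lambda]_F\mapsto[\lambda]_E$); as a subset of $\widetilde{X}$ it equals $\phi^{-1}( * )$. Every path $c:[0,1]\to X$ with $c(0)=*$ has a unique continuous lift $c_L:[0,1]\to\widetilde{X}$ with $c_L(0)=*$ and $\phi\circ c_L=c$. The natural homomorphism $\lambda:\pi_1(X)=\pi_1(X,* )\to\delta_1(X)$ is $\lambda([c])=c_L(1)\in\phi^{-1}( * )=\delta_1(X)$, which is well defined. *)

theory Defs
  imports "HOL-Analysis.Analysis" "HOL-Algebra.Group"
begin

definition semilocally_simply_connected :: "'a::topological_space set \<Rightarrow> bool" where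
  "semilocally_simply_connected S \<longleftrightarrow>
     (\<forall>x\<in>S. \<exists>U. openin (top_of_set S) U \<and> x \<in> U \<and>
        (\<forall>c. path c \<and> path_image c \<subseteq> U \<and> pathstart c = x \<and> pathfinish c = x
             \<longrightarrow> homotopic_paths S c (\<lambda>_. x)))"

definition poincare_space :: "'a::topological_space set \<Rightarrow> bool" where
  "poincare_space S \<longleftrightarrow>
     connected S \<and> locally path_connected S \<and> semilocally_simply_connected S"

text \<open>The library notions \<^const>\<open>simply_connected\<close> and \<^const>\<open>covering_space\<close> only concern
  subsets of types of class \<^class>\<open>topological_space\<close>. The inverse limit below depends on a
  basepoint and is not such a type, so the notions are needed for abstract topologies.\<close>

definition simply_connected_space :: "'b topology \<Rightarrow> bool" where
  "simply_connected_space T \<longleftrightarrow>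
     path_connected_space T \<and>
     (\<forall>c. pathin T c \<and> c 0 = c 1 \<longrightarrow>
        homotopic_with (\<lambda>h. h 0 = c 0 \<and> h 1 = c 1) (top_of_set {0..1}) T c (\<lambda>_. c 0))"

definition covering_map :: "'b topology \<Rightarrow> 'c topology \<Rightarrow> ('b \<Rightarrow> 'c) \<Rightarrow> bool" where
  "covering_map T X p \<longleftrightarrow>
     continuous_map T X p \<and> p ` topspace T = topspace X \<and>
     (\<forall>x\<in>topspace X. \<exists>U. openin X U \<and> x \<in> U \<and>
        (\<exists>\<V>. \<Union>\<V> = {t \<in> topspace T. p t \<in> U} \<and> (\<forall>V\<in>\<V>. openin T V) \<and> pairwise disjnt \<V> \<and>
             (\<forall>V\<in>\<V>. homeomorphic_map (subtopology T V) (subtopology X U) p)))"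

definition universal_covering_map :: "'b topology \<Rightarrow> 'c topology \<Rightarrow> ('b \<Rightarrow> 'c) \<Rightarrow> bool" where
  "universal_covering_map T X p \<longleftrightarrow> covering_map T X p \<and> simply_connected_space T"

definition path_class :: "(real \<Rightarrow> 'a::topological_space) \<Rightarrow> (real \<Rightarrow> 'a) set" where
  "path_class c = {d. homotopic_paths UNIV c d}"

definition pi1 :: "'a::topological_space \<Rightarrow> (real \<Rightarrow> 'a) set monoid" where
  "pi1 b = \<lparr>carrier = {path_class c | c. path c \<and> pathstart c = b \<and> pathfinish c = b},
            mult = (\<lambda>P Q. \<Union>c\<in>P. \<Union>d\<in>Q. path_class (c +++ d)),
            one = path_class (\<lambda>_. b)\<rparr>"

definition entourages :: "('a::uniform_space \<times> 'a) set set" where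
  "entourages = {E. sym E \<and> (\<forall>\<^sub>F p in uniformity. p \<in> E)}"

definition is_chain :: "('a \<times> 'a) set \<Rightarrow> 'a \<Rightarrow> 'a \<Rightarrow> 'a list \<Rightarrow> bool" where
  "is_chain E p q xs \<longleftrightarrow>
     xs \<noteq> [] \<and> hd xs = p \<and> last xs = q \<and> successively (\<lambda>x y. (x, y) \<in> E) xs"

definition add_point :: "('a \<times> 'a) set \<Rightarrow> 'a list \<Rightarrow> 'a list \<Rightarrow> bool" where
  "add_point E \<alpha> \<beta> \<longleftrightarrow>
     (\<exists>p q xs y zs. \<alpha> = xs @ zs \<and> \<beta> = xs @ y # zs \<and> is_chain E p q \<alpha> \<and> is_chain E p q \<beta>)"

definition chain_class :: "('a \<times> 'a) set \<Rightarrow> 'a list \<Rightarrow> 'a list set" where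
  "chain_class E \<alpha> = {\<beta>. equivclp (add_point E) \<alpha> \<beta>}"

definition chain_space :: "'a \<Rightarrow> ('a \<times> 'a) set \<Rightarrow> 'a list set set" where
  "chain_space b E = {chain_class E \<alpha> | \<alpha> q. is_chain E b q \<alpha>}"

text \<open>The map from F-classes to E-classes, for F contained in E.\<close>

definition bonding :: "('a \<times> 'a) set \<Rightarrow> 'a list set \<Rightarrow> 'a list set" where
  "bonding E C = (\<Union>\<alpha>\<in>C. chain_class E \<alpha>)"

definition star_rel :: "'a \<Rightarrow> ('a \<times> 'a) set \<Rightarrow> ('a \<times> 'a) set \<Rightarrow> ('a list set \<times> 'a list set) set" where
  "star_rel b E D =
     {(chain_class E (b # xs @ [y]), chain_class E (b # xs @ [z])) | xs y z.
        is_chain E b y (b # xs @ [y]) \<and> is_chain E b z (b # xs @ [z]) \<and> (y, z) \<in> D}"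

definition chain_uniformity ::
    "'a::uniform_space \<Rightarrow> ('a \<times> 'a) set \<Rightarrow> ('a list set \<times> 'a list set) filter" where
  "chain_uniformity b E = (INF D\<in>{D \<in> entourages. D \<subseteq> E}. principal (star_rel b E D))"

text \<open>Points of the inverse limit are functions on the set of entourages; as usual for
  \<^const>\<open>PiE\<close>, they are undefined elsewhere.\<close>

definition Xtilde :: "'a::uniform_space \<Rightarrow> (('a \<times> 'a) set \<Rightarrow> 'a list set) set" where
  "Xtilde b = {x \<in> (\<Pi>\<^sub>E E\<in>entourages. chain_space b E).
                 \<forall>E\<in>entourages. \<forall>F\<in>entourages. F \<subseteq> E \<longrightarrow> bonding E (x F) = x E}"

definition Xtilde_base :: "'a::uniform_space \<Rightarrow> ('a \<times> 'a) set \<Rightarrow> 'a list set" where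
  "Xtilde_base b = (\<lambda>E\<in>entourages. chain_class E [b])"

definition Xtilde_uniformity :: "'a::uniform_space \<Rightarrow>
    ((('a \<times> 'a) set \<Rightarrow> 'a list set) \<times> (('a \<times> 'a) set \<Rightarrow> 'a list set)) filter" where
  "Xtilde_uniformity b =
     inf (principal (Xtilde b \<times> Xtilde b))
         (INF E\<in>entourages. filtercomap (\<lambda>(x, y). (x E, y E)) (chain_uniformity b E))"

text \<open>The topology induced on a set by a uniformity on it, as in the class axiom
  \<open>open_uniformity\<close>.\<close>

definition uniform_topology :: "'b set \<Rightarrow> ('b \<times> 'b) filter \<Rightarrow> 'b topology" where
  "uniform_topology S \<U> =
     topology (\<lambda>A. A \<subseteq> S \<and> (\<forall>x\<in>A. \<forall>\<^sub>F (x', y) in \<U>. x' = x \<longrightarrow> y \<in> A))"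

lemma openin_uniform_topology:
  "openin (uniform_topology S \<U>) A \<longleftrightarrow>
     A \<subseteq> S \<and> (\<forall>x\<in>A. \<forall>\<^sub>F (x', y) in \<U>. x' = x \<longrightarrow> y \<in> A)"
proof -
  let ?O = "\<lambda>A. A \<subseteq> S \<and> (\<forall>x\<in>A. \<forall>\<^sub>F (x', y) in \<U>. x' = x \<longrightarrow> y \<in> A)"
  have "?O (A \<inter> B)" if "?O A" "?O B" for A B
  proof (intro conjI ballI)
    fix x assume "x \<in> A \<inter> B"
    with that have "\<forall>\<^sub>F (x', y) in \<U>. x' = x \<longrightarrow> y \<in> A" "\<forall>\<^sub>F (x', y) in \<U>. x' = x \<longrightarrow> y \<in> B"
      by auto
    then show "\<forall>\<^sub>F (x', y) in \<U>. x' = x \<longrightarrow> y \<in> A \<inter> B"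
      by eventually_elim auto
  qed (use that in auto)
  moreover have "?O (\<Union>\<K>)" if "\<forall>K\<in>\<K>. ?O K" for \<K>
  proof (intro conjI ballI)
    fix x assume "x \<in> \<Union>\<K>"
    then obtain K where K: "K \<in> \<K>" "x \<in> K" by blast
    with that have "\<forall>\<^sub>F (x', y) in \<U>. x' = x \<longrightarrow> y \<in> K" by blast
    then show "\<forall>\<^sub>F (x', y) in \<U>. x' = x \<longrightarrow> y \<in> \<Union>\<K>"
      by eventually_elim (use K in auto)
  qed (use that in auto)
  ultimately have "istopology ?O"
    unfolding istopology_def by blast
  then show ?thesis
    by (simp add: uniform_topology_def)
qed

definition Xtilde_top :: "'a::uniform_space \<Rightarrow> (('a \<times> 'a) set \<Rightarrow> 'a list set) topology" where
  "Xtilde_top b = uniform_topology (Xtilde b) (Xtilde_uniformity b)"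

lemma topspace_Xtilde_top: "topspace (Xtilde_top b) = Xtilde b"
proof -
  have "\<forall>\<^sub>F (x', y) in Xtilde_uniformity b. x' = x \<longrightarrow> y \<in> Xtilde b" for x
    unfolding Xtilde_uniformity_def
    by (rule filter_leD[OF inf_le1]) (auto simp: eventually_principal)
  then have "openin (Xtilde_top b) (Xtilde b)"
    by (simp add: Xtilde_top_def openin_uniform_topology)
  moreover have "A \<subseteq> Xtilde b" if "openin (Xtilde_top b) A" for A
    using that by (simp add: Xtilde_top_def openin_uniform_topology)
  ultimately show ?thesis
    by (metis openin_subset openin_topspace subset_antisym)
qed

text \<open>A class of chains for the total entourage is identified with the common last point of
  its members.\<close>

definition Xtilde_proj :: "(('a \<times> 'a) set \<Rightarrow> 'a list set) \<Rightarrow> 'a" where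
  "Xtilde_proj x = the_elem (last ` x UNIV)"

definition delta :: "'a \<Rightarrow> ('a \<times> 'a) set \<Rightarrow> 'a list set monoid" where
  "delta b E = \<lparr>carrier = {chain_class E \<alpha> | \<alpha>. is_chain E b b \<alpha>},
                mult = (\<lambda>A B. \<Union>\<alpha>\<in>A. \<Union>\<beta>\<in>B. chain_class E (\<alpha> @ tl \<beta>)),
                one = chain_class E [b]\<rparr>"

definition delta1 :: "'a::uniform_space \<Rightarrow> (('a \<times> 'a) set \<Rightarrow> 'a list set) monoid" where
  "delta1 b = \<lparr>carrier = {x \<in> (\<Pi>\<^sub>E E\<in>entourages. carrier (delta b E)).
                            \<forall>E\<in>entourages. \<forall>F\<in>entourages. F \<subseteq> E \<longrightarrow> bonding E (x F) = x E},
               mult = (\<lambda>x y. \<lambda>E\<in>entourages. x E \<otimes>\<^bsub>delta b E\<^esub> y E),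
               one = (\<lambda>E\<in>entourages. \<one>\<^bsub>delta b E\<^esub>)\<rparr>"

definition is_lift :: "'a::uniform_space \<Rightarrow> (real \<Rightarrow> 'a) \<Rightarrow>
    (real \<Rightarrow> ('a \<times> 'a) set \<Rightarrow> 'a list set) \<Rightarrow> bool" where
  "is_lift b c l \<longleftrightarrow>
     pathin (Xtilde_top b) l \<and> l 0 = Xtilde_base b \<and> (\<forall>t\<in>{0..1}. Xtilde_proj (l t) = c t)"

text \<open>Paths are total functions on the reals whose values outside the unit interval are
  irrelevant; the lift is made unique by fixing its values there.\<close>

definition path_lift :: "'a::uniform_space \<Rightarrow> (real \<Rightarrow> 'a) \<Rightarrow>
    real \<Rightarrow> ('a \<times> 'a) set \<Rightarrow> 'a list set" where
  "path_lift b c = (THE l. l \<in> extensional {0..1} \<and> is_lift b c l)"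

definition lambda_map :: "'a::uniform_space \<Rightarrow> (real \<Rightarrow> 'a) set \<Rightarrow> ('a \<times> 'a) set \<Rightarrow> 'a list set" where
  "lambda_map b C = the_elem ((\<lambda>c. path_lift b c 1) ` C)"

end

theory Submission
  imports Defs
begin

text \<open>
  Send a path \<open>c\<close> from the basepoint to the family of the chains that it traces on ever finer
  partitions of the unit interval, one homotopy class of chains for every entourage. The proof shows
  that this map \<open>lift_end\<close> is a bijection from the homotopy classes of paths that start at the
  basepoint, that is, from the points of the classical construction of the universal cover, to
  \<open>Xtilde\<close>, and that it matches the topologies.

  The map is well defined because the class of a traced chain does not change under refinement, and
  is locally constant along a homotopy of paths (\<open>homotopic_paths_imp_chain_homotopic\<close>).

  For the inverse, compactness turns the two local hypotheses into uniform ones. There is an entourage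
  \<open>F\<^sub>0\<close> such that paths which stay \<open>(F\<^sub>0 O F\<^sub>0)\<close>-close to their common starting point are homotopic
  as soon as they have the same end, and for every entourage \<open>F\<close> there is an entourage \<open>D\<close> such that
  \<open>D\<close>-close points are joined by a path of size \<open>F\<close>. Joining successive points of a sufficiently fine
  chain by small paths gives a path that is unique up to homotopy, and adding a point to the chain
  replaces one side of a small triangle by the two others, which is a homotopy (\<open>realize_homotopic\<close>).
  A path is homotopic to the realization of any fine chain on it, whence injectivity. A point of the
  inverse limit is determined by its coordinate at one sufficiently fine entourage, because every finer
  coordinate has the same realization up to homotopy; hence surjectivity (\<open>lift_end_surj\<close>).

  Points of \<open>Xtilde\<close> close to the end of the lift of \<open>c\<close> are exactly those obtained by continuing \<open>c\<close>
  along a small path. Thus the sheets, obtained by continuing \<open>c\<close> inside an open set \<open>V\<close>, form a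
  base, and for a path connected \<open>V\<close> whose loops are trivial in the whole space they are disjoint
  copies of \<open>V\<close>. This is the covering. The lift of a path or of a square is written down by means of
  \<open>lift_end\<close> of its restrictions to segments, and lifts are unique; so a loop in \<open>Xtilde\<close>
  projects to a loop with trivial class, and a null-homotopy of the projection lifts. Finally
  \<open>\<lambda>\<close> maps the class of \<open>c\<close> to \<open>lift_end c\<close>, which is multiplicative because tracing respects
  concatenation.
\<close>

section \<open>Entourages\<close>

lemma entourage_refl: "E \<in> entourages \<Longrightarrow> (x, x) \<in> E"
  unfolding entourages_def using uniformity_refl[of "\<lambda>p. p \<in> E"] by auto

lemma entourage_sym: "E \<in> entourages \<Longrightarrow> (x, y) \<in> E \<Longrightarrow> (y, x) \<in> E"
  unfolding entourages_def by (auto dest: symD)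

lemma entourage_UNIV: "UNIV \<in> entourages"
  by (auto simp: entourages_def sym_def)

lemma entourage_Int: "E \<in> entourages \<Longrightarrow> F \<in> entourages \<Longrightarrow> E \<inter> F \<in> entourages"
  unfolding entourages_def by (auto simp: sym_Int eventually_conj)

lemma entourage_Inter:
  "finite I \<Longrightarrow> (\<And>i. i \<in> I \<Longrightarrow> E i \<in> entourages) \<Longrightarrow> (\<Inter>i\<in>I. E i) \<in> entourages"
  by (induction I rule: finite_induct) (auto intro: entourage_UNIV entourage_Int)

lemma entourage_within:
  assumes "eventually P uniformity"
  obtains E where "E \<in> entourages" "\<And>p. p \<in> E \<Longrightarrow> P p"
proof
  show "{(x, y). P (x, y) \<and> P (y, x)} \<in> entourages"
    using eventually_conj[OF assms uniformity_sym[OF assms]]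
    unfolding entourages_def by (auto simp: sym_def elim!: eventually_mono)
qed auto

lemma entourage_half:
  assumes "E \<in> entourages"
  obtains D where "D \<in> entourages" "D O D \<subseteq> E"
proof -
  have "eventually (\<lambda>p. p \<in> E) uniformity" using assms by (auto simp: entourages_def)
  then obtain P where P: "eventually P uniformity" "\<And>x y z. P (x, y) \<Longrightarrow> P (y, z) \<Longrightarrow> (x, z) \<in> E"
    by (rule uniformity_transE) blast
  obtain D where D: "D \<in> entourages" "\<And>p. p \<in> D \<Longrightarrow> P p"
    by (rule entourage_within[OF P(1)]) blast
  show thesis
    by (rule that[of D]) (use D P(2) in blast)+
qed

lemma entourage_subset_square:
  assumes "D \<in> entourages" "D O D \<subseteq> E"
  shows "D \<subseteq> E"
proof
  fix p assume "p \<in> D"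
  then have "(fst p, snd p) \<in> D O D" using entourage_refl[OF assms(1)] by (intro relcompI[of _ "fst p"]) auto
  with assms show "p \<in> E" by auto
qed

lemma entourage_Image_subset_open:
  assumes "open U" "x \<in> U"
  obtains E where "E \<in> entourages" "E `` {x} \<subseteq> U"
proof -
  have "\<forall>\<^sub>F (x', y) in uniformity. x' = x \<longrightarrow> y \<in> U"
    using assms open_uniformity by blast
  then obtain E where E: "E \<in> entourages" "\<And>p. p \<in> E \<Longrightarrow> (case p of (x', y) \<Rightarrow> x' = x \<longrightarrow> y \<in> U)"
    by (rule entourage_within) blast
  show thesis
    by (rule that[of E]) (use E in auto)
qed

lemma open_subset_entourage_Image:
  assumes "E \<in> entourages"
  obtains U where "open U" "x \<in> U" "U \<subseteq> E `` {x}"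
proof -
  have "eventually (\<lambda>y. y \<in> E `` {x}) (nhds x)"
    unfolding eventually_nhds_uniformity using assms
    by (auto simp: entourages_def elim: eventually_mono)
  then show thesis
    using that unfolding eventually_nhds by blast
qed

text \<open>The Lebesgue number lemma for uniformities: around each point choose an entourage whose
  square still fits into a member of the cover, and intersect finitely many of these.\<close>

lemma Lebesgue_entourage:
  assumes "compact (UNIV :: 'a::uniform_space set)"
    and cover: "\<And>x::'a. \<exists>V\<in>\<C>. open V \<and> x \<in> V"
  obtains D where "D \<in> entourages" "\<And>x::'a. \<exists>V\<in>\<C>. D `` {x} \<subseteq> V"
proof -
  have "\<exists>V E U. V \<in> \<C> \<and> E \<in> entourages \<and> (E O E) `` {x} \<subseteq> V \<and> open U \<and> x \<in> U \<and> U \<subseteq> E `` {x}" for x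
  proof -
    obtain V where V: "V \<in> \<C>" "open V" "x \<in> V" using cover by blast
    obtain E' where E': "E' \<in> entourages" "E' `` {x} \<subseteq> V"
      using V entourage_Image_subset_open by blast
    obtain E where E: "E \<in> entourages" "E O E \<subseteq> E'" using E' entourage_half by blast
    obtain U where "open U" "x \<in> U" "U \<subseteq> E `` {x}"
      using E open_subset_entourage_Image by blast
    with V E E' show ?thesis by blast
  qed
  then obtain V E U where VEU: "\<And>x. V x \<in> \<C>" "\<And>x. E x \<in> entourages"
      "\<And>x. (E x O E x) `` {x} \<subseteq> V x" "\<And>x. open (U x)" "\<And>x. x \<in> U x" "\<And>x. U x \<subseteq> E x `` {x}"
    by metis
  obtain I where I: "finite I" "UNIV \<subseteq> (\<Union>x\<in>I. U x)"
    using compactE_image[OF assms(1), of UNIV U] VEU by (metis UNIV_I UN_I subsetI)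
  show thesis
  proof
    show "(\<Inter>i\<in>I. E i) \<in> entourages" using I VEU entourage_Inter by blast
    fix x
    obtain i where "i \<in> I" "x \<in> U i" using I by blast
    then show "\<exists>V\<in>\<C>. (\<Inter>i\<in>I. E i) `` {x} \<subseteq> V"
      using VEU(3,6)[of i] by (intro bexI[OF _ VEU(1)[of i]]) blast
  qed
qed

lemma compact_continuous_entourage:
  fixes f :: "'b::metric_space \<Rightarrow> 'a::uniform_space"
  assumes "compact K" "continuous_on K f" "F \<in> entourages"
  obtains \<delta> where "\<delta> > 0" "\<And>z w. z \<in> K \<Longrightarrow> w \<in> K \<Longrightarrow> dist z w < \<delta> \<Longrightarrow> (f z, f w) \<in> F"
proof -
  obtain D where D: "D \<in> entourages" "D O D \<subseteq> F" using assms entourage_half by blast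
  have "\<exists>r>0. \<forall>w\<in>K. dist w z < r \<longrightarrow> (f z, f w) \<in> D" if "z \<in> K" for z
  proof -
    obtain U where U: "open U" "f z \<in> U" "U \<subseteq> D `` {f z}"
      using D open_subset_entourage_Image by blast
    have "\<forall>\<^sub>F w in at z within K. f w \<in> U"
      using assms(2) that U by (auto simp: continuous_on_def tendsto_def)
    then obtain r where "r > 0" "\<And>w. w \<in> K \<Longrightarrow> w \<noteq> z \<Longrightarrow> dist w z < r \<Longrightarrow> f w \<in> U"
      unfolding eventually_at by blast
    with U show ?thesis by (intro exI[of _ r]) blast
  qed
  then obtain r where r: "\<And>z. z \<in> K \<Longrightarrow> r z > 0"
      "\<And>z w. z \<in> K \<Longrightarrow> w \<in> K \<Longrightarrow> dist w z < r z \<Longrightarrow> (f z, f w) \<in> D"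
    by metis
  have "K \<subseteq> \<Union> ((\<lambda>z. ball z (r z)) ` K)" using r by auto
  then obtain e where e: "e > 0" "\<And>x. x \<in> K \<Longrightarrow> \<exists>G\<in>(\<lambda>z. ball z (r z)) ` K. ball x e \<subseteq> G"
    using Heine_Borel_lemma[OF assms(1)] by (metis (no_types, lifting) imageE open_ball)
  show thesis
  proof (rule that[OF \<open>e > 0\<close>])
    fix x w assume xw: "x \<in> K" "w \<in> K" "dist x w < e"
    then obtain z where z: "z \<in> K" "ball x e \<subseteq> ball z (r z)" using e by blast
    moreover have "x \<in> ball x e" "w \<in> ball x e" using xw e by auto
    ultimately have "x \<in> ball z (r z)" "w \<in> ball z (r z)" by blast+
    then have "(f z, f x) \<in> D" "(f z, f w) \<in> D" using r(2) z xw by (auto simp: dist_commute)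
    then show "(f x, f w) \<in> F" using D entourage_sym by blast
  qed
qed

section \<open>Chains\<close>

abbreviation chain_homotopic :: "('a \<times> 'a) set \<Rightarrow> 'a list \<Rightarrow> 'a list \<Rightarrow> bool" where
  "chain_homotopic E \<equiv> equivclp (add_point E)"

lemma chain_class_eq_iff: "chain_class E \<alpha> = chain_class E \<beta> \<longleftrightarrow> chain_homotopic E \<alpha> \<beta>"
proof
  assume "chain_class E \<alpha> = chain_class E \<beta>"
  then have "\<beta> \<in> chain_class E \<alpha>" by (simp add: chain_class_def)
  then show "chain_homotopic E \<alpha> \<beta>" by (simp add: chain_class_def)
next
  assume "chain_homotopic E \<alpha> \<beta>"
  then show "chain_class E \<alpha> = chain_class E \<beta>"
    unfolding chain_class_def by (auto intro: equivclp_trans equivclp_sym)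
qed

lemma chain_homotopic_preserves:
  assumes "chain_homotopic E \<alpha> \<beta>" "is_chain E p q \<alpha>"
  shows "is_chain E p q \<beta>"
  using assms by (induction rule: equivclp_induct) (auto simp: add_point_def is_chain_def)

text \<open>Homotopic chains keep their ends, so a map of chains with fixed ends respects homotopy once it
  respects the addition of a single point.\<close>

lemma chain_homotopic_map:
  assumes "chain_homotopic E \<alpha> \<beta>" "is_chain E p q \<alpha>"
    and step: "\<And>\<gamma> \<delta>. is_chain E p q \<gamma> \<Longrightarrow> is_chain E p q \<delta> \<Longrightarrow> add_point E \<gamma> \<delta> \<Longrightarrow> chain_homotopic F (f \<gamma>) (f \<delta>)"
  shows "chain_homotopic F (f \<alpha>) (f \<beta>)"
  using assms(1)
proof (induction rule: equivclp_induct)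
  case (step y z)
  have "is_chain E p q y" "is_chain E p q z"
    using step.hyps chain_homotopic_preserves[OF _ assms(2)]
    by (meson equivclp_into_equivclp)+
  then show ?case using assms(3) step by (meson equivclp_sym equivclp_trans)
qed auto

lemma is_chain_mono: "is_chain E p q \<alpha> \<Longrightarrow> E \<subseteq> F \<Longrightarrow> is_chain F p q \<alpha>"
  unfolding is_chain_def by (auto elim!: successively_mono)

lemma chain_homotopic_mono:
  assumes "chain_homotopic E \<alpha> \<beta>" "E \<subseteq> F"
  shows "chain_homotopic F \<alpha> \<beta>"
  using assms(1)
proof (induction rule: equivclp_induct)
  case (step y z)
  then have "add_point F y z \<or> add_point F z y"
    using is_chain_mono[OF _ assms(2)] unfolding add_point_def by blast
  then show ?case using step.IH by (meson equivclp_into_equivclp)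
qed auto

lemma is_chain_Cons:
  "is_chain E p q (x # y # \<alpha>) \<longleftrightarrow> p = x \<and> (x, y) \<in> E \<and> is_chain E y q (y # \<alpha>)"
  by (auto simp: is_chain_def)

lemma is_chain_single [simp]: "is_chain E p q [x] \<longleftrightarrow> p = x \<and> q = x"
  by (auto simp: is_chain_def)

lemma is_chain_join:
  assumes "is_chain E p q \<alpha>" "is_chain E q r \<beta>"
  shows "is_chain E p r (\<alpha> @ tl \<beta>)"
  using assms by (cases \<beta>; cases "tl \<beta>") (auto simp: is_chain_def successively_append_iff)

text \<open>The common point of two consecutive chains may be dropped from either of them; dropping it from
  the first leaves the second one intact, so that a point can be added there at any position.\<close>

lemma chain_join_eq:
  assumes "is_chain E p q \<alpha>" "is_chain E q r \<beta>"
  shows "\<alpha> @ tl \<beta> = butlast \<alpha> @ \<beta>"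
  using assms unfolding is_chain_def
  by (metis append.assoc append_Cons append_butlast_last_id append_self_conv2 list.collapse)

lemma chain_homotopic_join_left:
  assumes "chain_homotopic E \<alpha> \<alpha>'" "is_chain E p q \<alpha>" "is_chain E q r \<beta>"
  shows "chain_homotopic E (\<alpha> @ tl \<beta>) (\<alpha>' @ tl \<beta>)"
  using assms(1,2)
proof (rule chain_homotopic_map)
  fix \<gamma> \<delta> assume c: "is_chain E p q \<gamma>" "is_chain E p q \<delta>" and a: "add_point E \<gamma> \<delta>"
  from a obtain xs y zs where "\<gamma> = xs @ zs" "\<delta> = xs @ y # zs" unfolding add_point_def by blast
  then have "add_point E (\<gamma> @ tl \<beta>) (\<delta> @ tl \<beta>)"
    using is_chain_join[OF c(1) assms(3)] is_chain_join[OF c(2) assms(3)]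
    unfolding add_point_def by (metis append.assoc append_Cons)
  then show "chain_homotopic E (\<gamma> @ tl \<beta>) (\<delta> @ tl \<beta>)" by blast
qed

lemma chain_homotopic_join_right:
  assumes "chain_homotopic E \<beta> \<beta>'" "is_chain E q r \<beta>" "is_chain E p q \<alpha>"
  shows "chain_homotopic E (\<alpha> @ tl \<beta>) (\<alpha> @ tl \<beta>')"
  using assms(1,2)
proof (rule chain_homotopic_map)
  fix \<gamma> \<delta> assume c: "is_chain E q r \<gamma>" "is_chain E q r \<delta>" and a: "add_point E \<gamma> \<delta>"
  from a obtain xs y zs where "\<gamma> = xs @ zs" "\<delta> = xs @ y # zs" unfolding add_point_def by blast
  then have "add_point E (butlast \<alpha> @ \<gamma>) (butlast \<alpha> @ \<delta>)"
    using is_chain_join[OF assms(3) c(1)] is_chain_join[OF assms(3) c(2)]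
      chain_join_eq[OF assms(3) c(1)] chain_join_eq[OF assms(3) c(2)]
    unfolding add_point_def by (metis append.assoc)
  then show "chain_homotopic E (\<alpha> @ tl \<gamma>) (\<alpha> @ tl \<delta>)"
    using chain_join_eq[OF assms(3) c(1)] chain_join_eq[OF assms(3) c(2)] by auto
qed

lemma chain_homotopic_Cons:
  assumes "chain_homotopic E \<alpha> \<beta>" "is_chain E y q \<alpha>" "(x, y) \<in> E"
  shows "chain_homotopic E (x # \<alpha>) (x # \<beta>)"
proof -
  have "is_chain E x y [x, y]" using assms by (simp add: is_chain_Cons)
  moreover have "is_chain E y q \<beta>" using assms chain_homotopic_preserves by metis
  ultimately show ?thesis
    using chain_homotopic_join_right[OF assms(1,2), of x "[x, y]"] assms(2)
      chain_join_eq[of E x y "[x, y]" q]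
    by simp
qed

lemma chain_homotopic_insert:
  assumes "is_chain E p q (xs @ x # z # zs)" "(x, y) \<in> E" "(y, z) \<in> E"
  shows "chain_homotopic E (xs @ x # z # zs) (xs @ x # y # z # zs)"
proof -
  have "is_chain E p q (xs @ x # y # z # zs)"
    using assms by (auto simp: is_chain_def successively_append_iff hd_append)
  then have "add_point E (xs @ x # z # zs) (xs @ x # y # z # zs)"
    unfolding add_point_def using assms(1)
    by (intro exI[of _ p] exI[of _ q] exI[of _ "xs @ [x]"] exI[of _ y] exI[of _ "z # zs"]) auto
  then show ?thesis by blast
qed

lemma chain_homotopic_repeat_last:
  assumes "is_chain E p q (xs @ [x])" "(x, x) \<in> E"
  shows "chain_homotopic E (xs @ [x]) (xs @ [x, x])"
proof -
  have "is_chain E p q (xs @ [x, x])"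
    using assms by (auto simp: is_chain_def successively_append_iff hd_append)
  then have "add_point E (xs @ [x]) (xs @ [x, x])"
    unfolding add_point_def using assms(1)
    by (intro exI[of _ p] exI[of _ q] exI[of _ "xs @ [x]"] exI[of _ x] exI[of _ "[]"]) auto
  then show ?thesis by blast
qed

lemma chain_homotopic_repeat_hd:
  assumes "is_chain E p q (x # xs)" "(x, x) \<in> E"
  shows "chain_homotopic E (x # xs) (x # x # xs)"
proof -
  have "is_chain E p q (x # x # xs)"
    using assms by (auto simp: is_chain_def)
  then have "add_point E (x # xs) (x # x # xs)"
    unfolding add_point_def using assms(1)
    by (intro exI[of _ p] exI[of _ q] exI[of _ "[]"] exI[of _ x] exI[of _ "x # xs"]) auto
  then show ?thesis by blast
qed

text \<open>Two chains that run close to each other and end at the same point are homotopic: replace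
  the points of one by those of the other, one at a time, starting at the far end. The diagonal
  steps from the first chain to the second keep every intermediate sequence a chain.\<close>

lemma close_chains_homotopic_aux:
  assumes "successively (\<lambda>s t. (f s, f t) \<in> E \<and> (g s, g t) \<in> E \<and> (f s, g t) \<in> E) (t # ts)"
    and "\<And>s. s \<in> set (t # ts) \<Longrightarrow> (f s, g s) \<in> E"
    and "f (last (t # ts)) = g (last (t # ts))"
  shows "chain_homotopic E (map f (t # ts)) (f t # map g (t # ts)) \<and>
         is_chain E (f t) (f (last (t # ts))) (map f (t # ts)) \<and>
         is_chain E (g t) (f (last (t # ts))) (map g (t # ts))"
  using assms
proof (induction ts arbitrary: t)
  case Nil
  then show ?case using chain_homotopic_repeat_hd[of E "f t" "f t" "f t" "[]"] by auto
next
  case (Cons u ts)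
  let ?q = "f (last (u # ts))"
  from Cons.prems have IH: "chain_homotopic E (map f (u # ts)) (f u # map g (u # ts))"
      "is_chain E (f u) ?q (map f (u # ts))" "is_chain E (g u) ?q (map g (u # ts))"
    using Cons.IH[of u] by auto
  from Cons.prems have E: "(f t, f u) \<in> E" "(g t, g u) \<in> E" "(f t, g u) \<in> E" "(f t, g t) \<in> E" by auto
  have "chain_homotopic E (f t # map f (u # ts)) (f t # f u # map g (u # ts))"
    by (rule chain_homotopic_Cons[OF IH(1,2) E(1)])
  also have "chain_homotopic E (f t # f u # map g (u # ts)) (f t # map g (u # ts))"
    using chain_homotopic_insert[of E "f t" ?q "[]" "f t" "g u" "map g ts" "f u"] E Cons.prems(2)[of u] IH
    by (auto simp: is_chain_Cons intro: equivclp_sym)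
  also have "chain_homotopic E (f t # map g (u # ts)) (f t # g t # map g (u # ts))"
    using chain_homotopic_insert[of E "f t" ?q "[]" "f t" "g u" "map g ts" "g t"] E IH
    by (auto simp: is_chain_Cons)
  finally show ?case using IH E by (simp add: is_chain_Cons)
qed

lemma close_chains_homotopic:
  assumes "successively (\<lambda>s t. (f s, f t) \<in> E \<and> (g s, g t) \<in> E \<and> (f s, g t) \<in> E) ts" "ts \<noteq> []"
    and "\<And>s. s \<in> set ts \<Longrightarrow> (f s, g s) \<in> E"
    and "f (hd ts) = g (hd ts)" "f (last ts) = g (last ts)"
  shows "chain_homotopic E (map f ts) (map g ts)"
proof -
  obtain t us where ts: "ts = t # us" using assms(2) by (cases ts) auto
  have "chain_homotopic E (map f ts) (f t # map g ts)"
    and c: "is_chain E (g t) (f (last ts)) (map g ts)"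
    using close_chains_homotopic_aux[of f E g t us] assms ts by auto
  moreover have "chain_homotopic E (map g ts) (f t # map g ts)"
    using chain_homotopic_repeat_hd[of E "g t" "f (last ts)" "g t" "map g us"] c assms(3,4) ts
    by force
  ultimately show ?thesis by (meson equivclp_sym equivclp_trans)
qed

section \<open>Sampling paths\<close>

text \<open>The chain that a path traces on a partition of the unit interval depends, up to homotopy of
  chains, only on the path as long as the path moves by less than the entourage on each piece.
  Repeated partition points are allowed, so that inserting a point never needs a case distinction.\<close>

definition fine_partition :: "('a \<times> 'a) set \<Rightarrow> (real \<Rightarrow> 'a) \<Rightarrow> real list \<Rightarrow> bool" where
  "fine_partition E c ts \<longleftrightarrow> ts \<noteq> [] \<and> hd ts = 0 \<and> last ts = 1 \<and>
     successively (\<lambda>s t. s \<le> t \<and> (\<forall>u\<in>{s..t}. \<forall>v\<in>{s..t}. (c u, c v) \<in> E)) ts"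

lemma fine_partition_sorted: "fine_partition E c ts \<Longrightarrow> sorted ts"
  unfolding fine_partition_def
  by (subst successively_conv_sorted_wrt[symmetric])
    (auto simp: transp_def elim!: successively_mono)

lemma fine_partition_bounds:
  assumes "fine_partition E c ts" "t \<in> set ts"
  shows "0 \<le> t" "t \<le> 1"
proof -
  have s: "sorted ts" and ts: "ts \<noteq> []" "hd ts = 0" "last ts = 1"
    using assms(1) fine_partition_sorted by (auto simp: fine_partition_def)
  from assms(2) obtain i where i: "i < length ts" "t = ts ! i" by (auto simp: in_set_conv_nth)
  have "ts ! 0 \<le> ts ! i" "ts ! i \<le> ts ! (length ts - 1)"
    using s i by (auto intro!: sorted_nth_mono)
  with ts i show "0 \<le> t" "t \<le> 1" by (auto simp: hd_conv_nth last_conv_nth)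
qed

lemma fine_partition_mono: "fine_partition E c ts \<Longrightarrow> E \<subseteq> F \<Longrightarrow> fine_partition F c ts"
  unfolding fine_partition_def by (auto elim!: successively_mono)

lemma fine_partition_chain:
  assumes "fine_partition E c ts"
  shows "is_chain E (c 0) (c 1) (map c ts)"
  using assms unfolding fine_partition_def is_chain_def
  by (auto simp: hd_map last_map successively_map elim!: successively_mono)

lemma fine_partition_ends: "fine_partition E c ts \<Longrightarrow> \<exists>us. ts = 0 # us @ [1]"
  unfolding fine_partition_def
  by (metis append_Nil append_butlast_last_id hd_Cons_tl hd_append list.sel(1) list.sel(3) tl_append2 zero_neq_one)

lemma bracketing_consecutive_pair:
  fixes u :: "'b::linorder"
  assumes "ts \<noteq> []" "hd ts \<le> u" "u \<le> last ts" "hd ts \<noteq> last ts"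
  shows "\<exists>as s t bs. ts = as @ s # t # bs \<and> s \<le> u \<and> u \<le> t"
  using assms
proof (induction ts)
  case (Cons s ts)
  then obtain t r where ts: "ts = t # r" by (cases ts) auto
  show ?case
  proof (cases "u \<le> t")
    case True
    then show ?thesis using Cons.prems ts by (intro exI[of _ "[]"]) auto
  next
    case False
    then have "\<exists>as s t bs. ts = as @ s # t # bs \<and> s \<le> u \<and> u \<le> t"
      using Cons.prems ts by (intro Cons.IH) auto
    then show ?thesis by (metis append_Cons)
  qed
qed auto

lemma fine_partition_insert:
  assumes f: "fine_partition E c ts" and u: "0 \<le> u" "u \<le> 1"
  shows "\<exists>us. fine_partition E c us \<and> mset us = add_mset u (mset ts) \<and>
              chain_homotopic E (map c ts) (map c us)"
proof -
  obtain as s t bs where ts: "ts = as @ s # t # bs" "s \<le> u" "u \<le> t"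
    using bracketing_consecutive_pair[of ts u] f u by (auto simp: fine_partition_def)
  have st: "\<forall>v\<in>{s..t}. \<forall>w\<in>{s..t}. (c v, c w) \<in> E"
    using f ts by (auto simp: fine_partition_def successively_append_iff)
  have "fine_partition E c (as @ s # u # t # bs)"
    using f ts st by (auto simp: fine_partition_def successively_append_iff hd_append)
  moreover have "chain_homotopic E (map c ts) (map c (as @ s # u # t # bs))"
    using chain_homotopic_insert[of E "c 0" "c 1" "map c as" "c s" "c t" "map c bs" "c u"]
      fine_partition_chain[OF f] ts st
    by auto
  ultimately show ?thesis using ts by (intro exI[of _ "as @ s # u # t # bs"]) auto
qed

lemma fine_partition_refine:
  assumes "fine_partition E c ts" "\<And>u. u \<in> set us \<Longrightarrow> 0 \<le> u \<and> u \<le> 1"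
  shows "\<exists>vs. fine_partition E c vs \<and> mset vs = mset us + mset ts \<and>
              chain_homotopic E (map c ts) (map c vs)"
  using assms(2)
proof (induction us)
  case Nil
  then show ?case using assms(1) by auto
next
  case (Cons u us)
  then obtain vs where vs: "fine_partition E c vs" "mset vs = mset us + mset ts"
      "chain_homotopic E (map c ts) (map c vs)" by auto
  obtain ws where "fine_partition E c ws" "mset ws = add_mset u (mset vs)"
      "chain_homotopic E (map c vs) (map c ws)"
    using fine_partition_insert[OF vs(1)] Cons.prems by (metis list.set_intros(1))
  then show ?case using vs by (intro exI[of _ ws]) (auto intro: equivclp_trans)
qed

text \<open>Merging two partitions, with multiplicities, gives a common refinement that is reached from both
  by insertions, and a sorted list is determined by its multiset.\<close>

lemma fine_partition_unique:
  assumes "fine_partition E c ts" "fine_partition E c us"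
  shows "chain_homotopic E (map c ts) (map c us)"
proof -
  obtain vs where vs: "fine_partition E c vs" "mset vs = mset us + mset ts"
      "chain_homotopic E (map c ts) (map c vs)"
    using fine_partition_refine[OF assms(1)] fine_partition_bounds[OF assms(2)] by blast
  obtain ws where ws: "fine_partition E c ws" "mset ws = mset ts + mset us"
      "chain_homotopic E (map c us) (map c ws)"
    using fine_partition_refine[OF assms(2)] fine_partition_bounds[OF assms(1)] by blast
  have "vs = ws"
    using properties_for_sort[of vs ws] properties_for_sort[of ws ws] vs ws fine_partition_sorted
    by (metis add.commute)
  with vs ws show ?thesis by (meson equivclp_sym equivclp_trans)
qed

lemma fine_partition_exists:
  fixes c :: "real \<Rightarrow> 'a::uniform_space"
  assumes "path c" "E \<in> entourages"
  obtains ts where "fine_partition E c ts"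
proof -
  obtain \<delta> where d: "\<delta> > 0" "\<And>z w. z \<in> {0..1} \<Longrightarrow> w \<in> {0..1} \<Longrightarrow> dist z w < \<delta> \<Longrightarrow> (c z, c w) \<in> E"
    using compact_continuous_entourage[of "{0..1}" c E] assms by (auto simp: path_def)
  obtain n :: nat where n: "n > 0" "1 / real n < \<delta>"
    using d(1) by (metis nat_approx_posE zero_less_Suc)
  define ts where "ts = map (\<lambda>i. real i / real n) [0..<Suc n]"
  have "(c u, c v) \<in> E"
    if "i < n" "u \<in> {real i / n..real (Suc i) / n}" "v \<in> {real i / n..real (Suc i) / n}" for i u v
  proof (rule d(2))
    have "real (Suc i) / n = real i / n + 1 / n" by (simp add: add_divide_distrib)
    then show "dist u v < \<delta>" using that n by (auto simp: dist_real_def)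
    have "real (Suc i) / n \<le> 1" using that n by simp
    moreover have "0 \<le> real i / n" by simp
    ultimately show "u \<in> {0..1}" "v \<in> {0..1}" using that by (meson atLeastAtMost_iff order_trans)+
  qed
  then have "fine_partition E c ts"
    using n unfolding fine_partition_def ts_def
    by (auto simp: successively_map successively_conv_nth hd_map last_map divide_right_mono
        simp del: upt_Suc)
  then show thesis by (rule that)
qed

lemma fine_partition_join:
  assumes c: "fine_partition E c ts" and d: "fine_partition E d us" and cd: "c 1 = d 0"
  obtains vs where "fine_partition E (c +++ d) vs" "map (c +++ d) vs = map c ts @ tl (map d us)"
proof -
  define P where "P f s t \<longleftrightarrow> s \<le> t \<and> (\<forall>u\<in>{s..t}. \<forall>v\<in>{s..t}. (f u, f v) \<in> E)" for f and s t :: real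
  define ts' us' where "ts' = map (\<lambda>t. t/2) ts" "us' = map (\<lambda>u. (u + 1)/2) us"
  obtain us0 where us0: "us = 0 # us0" using d by (cases us) (auto simp: fine_partition_def)
  have left: "(c +++ d) (t/2) = c t" if "t \<le> 1" for t
    using that by (simp add: joinpaths_def)
  have right: "(c +++ d) ((u + 1)/2) = d u" if "0 \<le> u" for u
    using that cd by (cases "u = 0") (auto simp: joinpaths_def field_simps)
  have "successively (P (c +++ d)) ts'"
  proof -
    have "successively (P c) ts" using c by (simp add: fine_partition_def P_def[abs_def])
    moreover have "P (c +++ d) (s/2) (t/2)" if "P c s t" "t \<in> set ts" for s t
      unfolding P_def
    proof (intro conjI ballI)
      fix u v assume uv: "u \<in> {s/2..t/2}" "v \<in> {s/2..t/2}"
      moreover have "t \<le> 1" using fine_partition_bounds c that by blast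
      ultimately show "((c +++ d) u, (c +++ d) v) \<in> E"
        using left[of "2 * u"] left[of "2 * v"] that by (auto simp: P_def)
    qed (use that in \<open>simp add: P_def\<close>)
    ultimately show ?thesis
      unfolding ts'_us'_def successively_map by (auto elim: successively_mono)
  qed
  moreover have "successively (P (c +++ d)) us'"
  proof -
    have "successively (P d) us" using d by (simp add: fine_partition_def P_def[abs_def])
    moreover have "P (c +++ d) ((s+1)/2) ((t+1)/2)" if "P d s t" "s \<in> set us" for s t
      unfolding P_def
    proof (intro conjI ballI)
      fix u v assume uv: "u \<in> {(s+1)/2..(t+1)/2}" "v \<in> {(s+1)/2..(t+1)/2}"
      moreover have "0 \<le> s" using fine_partition_bounds d that by blast
      ultimately show "((c +++ d) u, (c +++ d) v) \<in> E"
        using right[of "2 * u-1"] right[of "2 * v-1"] that by (auto simp: P_def)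
    qed (use that in \<open>simp add: P_def\<close>)
    ultimately show ?thesis
      unfolding ts'_us'_def successively_map by (auto elim: successively_mono)
  qed
  moreover have "last ts' = hd us'" "ts' \<noteq> []" "us' \<noteq> []" "hd ts' = 0" "last us' = 1"
    using c d by (auto simp: ts'_us'_def hd_map last_map fine_partition_def)
  ultimately have "fine_partition E (c +++ d) (ts' @ tl us')"
    unfolding fine_partition_def P_def[symmetric]
    by (cases us'; cases "tl us'") (auto simp: successively_append_iff)
  moreover have "map (c +++ d) (ts' @ tl us') = map c ts @ tl (map d us)"
    using left right fine_partition_bounds[OF c] fine_partition_bounds[OF d]
    unfolding ts'_us'_def us0 by auto
  ultimately show thesis by (rule that)
qed

lemma fine_partition_unit:
  assumes "\<And>u v. u \<in> {0..1} \<Longrightarrow> v \<in> {0..1} \<Longrightarrow> (c u, c v) \<in> E"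
  shows "fine_partition E c [0, 1]"
  using assms by (auto simp: fine_partition_def)

text \<open>Along a homotopy the class of the sampled chain is locally constant, hence constant: a
  partition that is fine for one path of the homotopy is almost fine for all nearby ones, and the
  sampled chains are close.\<close>

lemma homotopic_paths_imp_chain_homotopic:
  fixes c :: "real \<Rightarrow> 'a::uniform_space"
  assumes cd: "homotopic_paths UNIV c d" and E: "E \<in> entourages"
    and ts: "fine_partition E c ts" and us: "fine_partition E d us"
  shows "chain_homotopic E (map c ts) (map d us)"
proof -
  obtain h :: "real \<times> real \<Rightarrow> 'a" where h: "continuous_on ({0..1} \<times> {0..1}) h"
      "\<And>x. x \<in> {0..1} \<Longrightarrow> h (0, x) = c x" "\<And>x. x \<in> {0..1} \<Longrightarrow> h (1, x) = d x"
      "\<And>t. t \<in> {0..1} \<Longrightarrow> h (t, 0) = c 0" "\<And>t. t \<in> {0..1} \<Longrightarrow> h (t, 1) = c 1"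
  proof -
    obtain h :: "real \<times> real \<Rightarrow> 'a" where "continuous_on ({0..1} \<times> {0..1}) h"
        "\<forall>x\<in>{0..1}. h (0, x) = c x" "\<forall>x\<in>{0..1}. h (1, x) = d x"
        "\<forall>t\<in>{0..1}. pathstart (h \<circ> Pair t) = pathstart c \<and> pathfinish (h \<circ> Pair t) = pathfinish c"
      using cd unfolding homotopic_paths by (elim exE conjE, intro that) assumption+
    then show thesis
      by (intro that[of h]) (auto simp: pathstart_def pathfinish_def)
  qed
  define H where "H s = (\<lambda>t. h (s, t))" for s
  have path_H: "path (H s)" if "s \<in> {0..1}" for s
    unfolding path_def H_def
    by (rule continuous_on_compose2[OF h(1)]) (use that in \<open>auto intro!: continuous_intros\<close>)
  obtain E' where E': "E' \<in> entourages" "E' O E' \<subseteq> E" using E entourage_half by blast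
  \<comment> \<open>A fourth part of \<open>E\<close>: comparing two points of a nearby path takes three steps in \<open>F\<close>.\<close>
  obtain F where F: "F \<in> entourages" "F O F \<subseteq> E'" using E' entourage_half by blast
  have FE: "F \<subseteq> E'" "E' \<subseteq> E" by (rule entourage_subset_square[OF F], rule entourage_subset_square[OF E'])
  obtain \<delta> where \<delta>: "\<delta> > 0" "\<And>z w. z \<in> {0..1} \<times> {0..1} \<Longrightarrow> w \<in> {0..1} \<times> {0..1} \<Longrightarrow> dist z w < \<delta> \<Longrightarrow> (h z, h w) \<in> F"
    by (rule compact_continuous_entourage[OF compact_Times[OF compact_Icc compact_Icc] h(1) F(1)]) blast
  have near: "(H s u, H s' u) \<in> F" if "s \<in> {0..1}" "s' \<in> {0..1}" "u \<in> {0..1}" "dist s s' < \<delta>" for s s' u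
    unfolding H_def using that by (intro \<delta>(2)) (auto simp: dist_Pair_Pair)
  define R where "R s s' \<longleftrightarrow> (\<forall>ts us. fine_partition E (H s) ts \<longrightarrow> fine_partition E (H s') us \<longrightarrow>
      chain_homotopic E (map (H s) ts) (map (H s') us))" for s s'
  have loc: "R s s'" if s: "s \<in> {0..1}" "s' \<in> {0..1}" "dist s s' < \<delta>" for s s'
  proof -
    obtain vs where vs: "fine_partition F (H s) vs" using fine_partition_exists path_H F s by blast
    have vs_E: "fine_partition E (H s) vs"
      using vs FE fine_partition_mono by (metis order_trans)
    have diag: "(H s u, H s' v) \<in> E'" if "u \<in> {a..b}" "v \<in> {a..b}" "0 \<le> a" "b \<le> 1"
        "\<forall>u\<in>{a..b}. \<forall>v\<in>{a..b}. (H s u, H s v) \<in> F" for u v a b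
    proof -
      have "(H s u, H s v) \<in> F" "(H s v, H s' v) \<in> F" using that near[OF s(1,2) _ s(3), of v] by auto
      then show ?thesis using F by blast
    qed
    have fin: "(H s' u, H s' v) \<in> E" if "u \<in> {a..b}" "v \<in> {a..b}" "0 \<le> a" "b \<le> 1"
        "\<forall>u\<in>{a..b}. \<forall>v\<in>{a..b}. (H s u, H s v) \<in> F" for u v a b
    proof -
      have "(H s u, H s' u) \<in> F" using that near[OF s(1,2) _ s(3), of u] by auto
      then have "(H s' u, H s u) \<in> E'" using F(1) FE(1) entourage_sym by blast
      then show ?thesis using diag[OF that] E' by blast
    qed
    have succ: "successively (\<lambda>a b. (a \<le> b \<and> (\<forall>u\<in>{a..b}. \<forall>v\<in>{a..b}. (H s' u, H s' v) \<in> E)) \<and>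
        (H s a, H s b) \<in> E \<and> (H s' a, H s' b) \<in> E \<and> (H s a, H s' b) \<in> E) vs"
      using vs[unfolded fine_partition_def, THEN conjunct2, THEN conjunct2, THEN conjunct2]
    proof (rule successively_mono)
      fix a b assume ab: "a \<in> set vs" "b \<in> set vs"
        "a \<le> b \<and> (\<forall>u\<in>{a..b}. \<forall>v\<in>{a..b}. (H s u, H s v) \<in> F)"
      have ab01: "0 \<le> a" "b \<le> 1" using fine_partition_bounds[OF vs] ab by auto
      have ends: "a \<in> {a..b}" "b \<in> {a..b}" using ab by auto
      have F_ab: "\<forall>u\<in>{a..b}. \<forall>v\<in>{a..b}. (H s u, H s v) \<in> F" using ab(3) by (rule conjunct2)
      have E_ab: "\<forall>u\<in>{a..b}. \<forall>v\<in>{a..b}. (H s' u, H s' v) \<in> E"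
        using fin[OF _ _ ab01 F_ab] by blast
      have "(H s a, H s b) \<in> E" using F_ab ends FE by (meson subsetD)
      moreover have "(H s a, H s' b) \<in> E" using diag[OF ends ab01 F_ab] FE by (meson subsetD)
      moreover have "(H s' a, H s' b) \<in> E" using E_ab ends by (meson subsetD)
      ultimately show "(a \<le> b \<and> (\<forall>u\<in>{a..b}. \<forall>v\<in>{a..b}. (H s' u, H s' v) \<in> E)) \<and>
        (H s a, H s b) \<in> E \<and> (H s' a, H s' b) \<in> E \<and> (H s a, H s' b) \<in> E"
        using conjunct1[OF ab(3)] E_ab by simp
    qed
    have vs': "fine_partition E (H s') vs"
    proof -
      have "successively (\<lambda>a b. a \<le> b \<and> (\<forall>u\<in>{a..b}. \<forall>v\<in>{a..b}. (H s' u, H s' v) \<in> E)) vs"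
        by (rule successively_mono[OF succ]) (rule conjunct1)
      with vs show ?thesis by (simp add: fine_partition_def)
    qed
    have "chain_homotopic E (map (H s) vs) (map (H s') vs)"
    proof (rule close_chains_homotopic)
      show "successively (\<lambda>a b. (H s a, H s b) \<in> E \<and> (H s' a, H s' b) \<in> E \<and> (H s a, H s' b) \<in> E) vs"
        by (rule successively_mono[OF succ]) (rule conjunct2)
      show "vs \<noteq> []" "H s (hd vs) = H s' (hd vs)" "H s (last vs) = H s' (last vs)"
        using vs h(4,5) s by (auto simp: fine_partition_def H_def)
      fix a assume "a \<in> set vs"
      then show "(H s a, H s' a) \<in> E"
        using near[OF s(1,2) _ s(3), of a] fine_partition_bounds[OF vs, of a] FE
        by (meson atLeastAtMost_iff subsetD)
    qed
    then show ?thesis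
      unfolding R_def
    proof (intro allI impI)
      fix ts us assume ts: "fine_partition E (H s) ts" and us: "fine_partition E (H s') us"
      show "chain_homotopic E (map (H s) ts) (map (H s') us)"
        by (rule equivclp_trans[OF fine_partition_unique[OF ts vs_E] equivclp_trans])
          (fact, rule fine_partition_unique[OF vs' us])
    qed
  qed
  have trans: "R s s''" if R: "R s s'" "R s' s''" and s': "s' \<in> {0..1}" for s s' s''
    unfolding R_def
  proof (intro allI impI)
    fix ts us assume "fine_partition E (H s) ts" "fine_partition E (H s'') us"
    moreover obtain vs where "fine_partition E (H s') vs"
      by (rule fine_partition_exists[OF path_H[OF s'] E])
    ultimately have "chain_homotopic E (map (H s) ts) (map (H s') vs)"
        "chain_homotopic E (map (H s') vs) (map (H s'') us)"
      using R unfolding R_def by simp_all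
    then show "chain_homotopic E (map (H s) ts) (map (H s'') us)" by (rule equivclp_trans)
  qed
  \<comment> \<open>The end of the homotopy is reached in finitely many steps shorter than \<open>\<delta>\<close>.\<close>
  obtain n :: nat where n: "n > 0" "1 / real n < \<delta>"
    using \<delta>(1) by (metis nat_approx_posE zero_less_Suc)
  have "R 0 (real i / n)" if "i \<le> n" for i
    using that
  proof (induction i)
    case 0
    then show ?case using loc[of 0 0] \<delta> by simp
  next
    case (Suc i)
    have i: "R 0 (real i / n)" using Suc.IH Suc.prems by simp
    have "R (real i / n) (real (Suc i) / n)"
    proof (rule loc)
      have "real (Suc i) / n = real i / n + 1 / n" by (simp add: add_divide_distrib)
      then show "dist (real i / n) (real (Suc i) / n) < \<delta>" using n by (simp add: dist_real_def)
    qed (use Suc.prems in auto)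
    then show ?case by (rule trans[OF i]) (use Suc.prems in simp)
  qed
  from this[of n] n have "R 0 1" by simp
  moreover have "fine_partition E (H 0) ts" "map (H 0) ts = map c ts"
    and "fine_partition E (H 1) us" "map (H 1) us = map d us"
  proof -
    have eq: "H 0 x = c x" "H 1 x = d x" if "0 \<le> x" "x \<le> 1" for x
      using h(2,3)[of x] that by (auto simp: H_def)
    show "map (H 0) ts = map c ts" "map (H 1) us = map d us"
      using eq fine_partition_bounds[OF ts] fine_partition_bounds[OF us] by auto
    have *: "fine_partition E g xs"
      if f: "fine_partition E f xs" and eq: "\<And>x. 0 \<le> x \<Longrightarrow> x \<le> 1 \<Longrightarrow> g x = f x" for f g xs
    proof -
      have "successively (\<lambda>s t. s \<le> t \<and> (\<forall>u\<in>{s..t}. \<forall>v\<in>{s..t}. (g u, g v) \<in> E)) xs"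
        using f[unfolded fine_partition_def, THEN conjunct2, THEN conjunct2, THEN conjunct2]
      proof (rule successively_mono)
        fix s t assume st: "s \<in> set xs" "t \<in> set xs"
          "s \<le> t \<and> (\<forall>u\<in>{s..t}. \<forall>v\<in>{s..t}. (f u, f v) \<in> E)"
        have "g u = f u" if "u \<in> {s..t}" for u
          using that fine_partition_bounds[OF f st(1)] fine_partition_bounds[OF f st(2)] by (intro eq) auto
        with st(3) show "s \<le> t \<and> (\<forall>u\<in>{s..t}. \<forall>v\<in>{s..t}. (g u, g v) \<in> E)" by simp
      qed
      with f show ?thesis by (simp add: fine_partition_def)
    qed
    show "fine_partition E (H 0) ts" by (rule *[OF ts eq(1)])
    show "fine_partition E (H 1) us" by (rule *[OF us eq(2)])
  qed
  ultimately show ?thesis unfolding R_def by metis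
qed

section \<open>Homotopies of paths\<close>

text \<open>Constant paths, reversed paths and restrictions of a path or of a square to segments are handled
  alike: all are images of paths in a convex set, where only the ends matter.\<close>

lemma homotopic_paths_convex_image:
  fixes f :: "'b::real_normed_vector \<Rightarrow> 'a::topological_space"
  assumes "continuous_on S f" "convex S" "path g" "path h" "path_image g \<subseteq> S" "path_image h \<subseteq> S"
    and "pathstart g = pathstart h" "pathfinish g = pathfinish h"
  shows "homotopic_paths UNIV (f \<circ> g) (f \<circ> h)"
proof (rule homotopic_paths_continuous_image[OF _ assms(1)])
  show "homotopic_paths S g h"
  proof (rule homotopic_paths_linear)
    fix t :: real assume "t \<in> {0..1}"
    then have "g t \<in> S" "h t \<in> S" using assms by (auto simp: path_image_def)
    then show "closed_segment (g t) (h t) \<subseteq> S" using assms(2) closed_segment_subset by blast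
  qed (use assms in auto)
qed auto

lemma path_comp_linepath:
  assumes "continuous_on S f" "convex S" "z \<in> S" "w \<in> S"
  shows "path (f \<circ> linepath z w)" "path_image (f \<circ> linepath z w) \<subseteq> f ` S"
    "pathstart (f \<circ> linepath z w) = f z" "pathfinish (f \<circ> linepath z w) = f w"
proof -
  have S: "path_image (linepath z w) \<subseteq> S" using assms closed_segment_subset by auto
  then show "path (f \<circ> linepath z w)"
    using path_continuous_image[OF _ continuous_on_subset[OF assms(1)]] by auto
  show "path_image (f \<circ> linepath z w) \<subseteq> f ` S" using S by (auto simp: path_image_compose)
qed (auto simp: pathstart_compose pathfinish_compose)

lemma comp_linepath_0_1: "c \<circ> linepath 0 1 = c"
  by (auto simp: linepath_def)

lemma homotopic_paths_join_linepaths: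
  fixes f :: "'b::real_normed_vector \<Rightarrow> 'a::topological_space"
  assumes "continuous_on S f" "convex S" "u \<in> S" "v \<in> S" "w \<in> S"
  shows "homotopic_paths UNIV ((f \<circ> linepath u v) +++ (f \<circ> linepath v w)) (f \<circ> linepath u w)"
  unfolding path_compose_join[symmetric]
  by (rule homotopic_paths_convex_image[OF assms(1,2)])
    (use assms closed_segment_subset[OF _ _ assms(2)] in \<open>auto simp: path_image_join\<close>)

lemma
  assumes "path p"
  shows homotopic_paths_const_right: "homotopic_paths UNIV (p +++ (\<lambda>_. pathfinish p)) p"
    and homotopic_paths_const_left: "homotopic_paths UNIV ((\<lambda>_. pathstart p) +++ p) p"
    and homotopic_paths_reverse_right: "homotopic_paths UNIV (p +++ reversepath p) (\<lambda>_. pathstart p)"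
    and homotopic_paths_reverse_left: "homotopic_paths UNIV (reversepath p +++ p) (\<lambda>_. pathfinish p)"
proof -
  have p: "continuous_on {0..1} p" using assms by (simp add: path_def)
  have *: "p \<circ> linepath 1 1 = (\<lambda>_. pathfinish p)" "p \<circ> linepath 0 0 = (\<lambda>_. pathstart p)"
      "p \<circ> linepath 1 0 = reversepath p"
    by (auto simp: linepath_def pathfinish_def pathstart_def reversepath_def)
  note j = homotopic_paths_join_linepaths[OF p convex_closed_interval, unfolded cbox_interval]
  show "homotopic_paths UNIV (p +++ (\<lambda>_. pathfinish p)) p"
    using j[of 0 1 1] by (simp add: * comp_linepath_0_1)
  show "homotopic_paths UNIV ((\<lambda>_. pathstart p) +++ p) p"
    using j[of 0 0 1] by (simp add: * comp_linepath_0_1)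
  show "homotopic_paths UNIV (p +++ reversepath p) (\<lambda>_. pathstart p)"
    using j[of 0 1 0] by (simp add: * comp_linepath_0_1)
  show "homotopic_paths UNIV (reversepath p +++ p) (\<lambda>_. pathfinish p)"
    using j[of 1 0 1] by (simp add: * comp_linepath_0_1)
qed

lemma homotopic_paths_assoc_UNIV:
  assumes "path p" "path q" "path r" "pathfinish p = pathstart q" "pathfinish q = pathstart r"
  shows "homotopic_paths UNIV ((p +++ q) +++ r) (p +++ (q +++ r))"
  using homotopic_paths_assoc[of p UNIV q r] assms by (auto intro: homotopic_paths_sym)

lemma homotopic_paths_cancel_left:
  assumes h: "homotopic_paths UNIV (r +++ p) (r +++ q)"
    and "path r" "path p" "path q" "pathfinish r = pathstart p" "pathfinish r = pathstart q"
  shows "homotopic_paths UNIV p q"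
proof -
  have *: "homotopic_paths UNIV (reversepath r +++ (r +++ s)) s"
    if "path s" "pathfinish r = pathstart s" for s
  proof -
    have "homotopic_paths UNIV (reversepath r +++ (r +++ s)) ((reversepath r +++ r) +++ s)"
      using homotopic_paths_assoc_UNIV[of "reversepath r" r s] assms that by (simp add: homotopic_paths_sym)
    also have "homotopic_paths UNIV ((reversepath r +++ r) +++ s) ((\<lambda>_. pathstart s) +++ s)"
      using homotopic_paths_reverse_left[of r] assms that by (intro homotopic_paths_join) auto
    also have "homotopic_paths UNIV ((\<lambda>_. pathstart s) +++ s) s"
      using homotopic_paths_const_left that by auto
    finally show ?thesis .
  qed
  have "homotopic_paths UNIV (reversepath r +++ (r +++ p)) (reversepath r +++ (r +++ q))"
    by (rule homotopic_paths_join[OF _ h]) (use assms in auto)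
  then show ?thesis
    using homotopic_paths_trans[OF homotopic_paths_sym[OF *] homotopic_paths_trans[OF _ *]] assms
    by blast
qed

lemma homotopic_paths_if_loop_null:
  assumes h: "homotopic_paths UNIV (p +++ reversepath q) (\<lambda>_. pathstart p)"
    and "path p" "path q" "pathfinish p = pathfinish q" "pathstart p = pathstart q"
  shows "homotopic_paths UNIV p q"
proof -
  have "homotopic_paths UNIV p (p +++ (\<lambda>_. pathfinish p))"
    by (rule homotopic_paths_sym[OF homotopic_paths_const_right[OF \<open>path p\<close>]])
  also have "homotopic_paths UNIV (p +++ (\<lambda>_. pathfinish p)) (p +++ (reversepath q +++ q))"
    using homotopic_paths_reverse_left[of q] assms
    by (intro homotopic_paths_join) (auto simp: homotopic_paths_sym pathstart_def)
  also have "homotopic_paths UNIV (p +++ (reversepath q +++ q)) ((p +++ reversepath q) +++ q)"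
    using homotopic_paths_assoc_UNIV[of p "reversepath q" q] assms by (simp add: homotopic_paths_sym)
  also have "homotopic_paths UNIV ((p +++ reversepath q) +++ q) ((\<lambda>_. pathstart q) +++ q)"
    using h assms by (intro homotopic_paths_join) auto
  also have "homotopic_paths UNIV ((\<lambda>_. pathstart q) +++ q) q"
    using homotopic_paths_const_left assms by auto
  finally show ?thesis .
qed

section \<open>Local conditions made uniform\<close>

text \<open>For path connected sets this says that the inclusion into the whole space is trivial on
  fundamental groups.\<close>

definition relatively_simply_connected :: "'a::topological_space set \<Rightarrow> bool" where
  "relatively_simply_connected V \<longleftrightarrow>
     (\<forall>p q. path p \<and> path q \<and> path_image p \<subseteq> V \<and> path_image q \<subseteq> V \<and>
        pathstart p = pathstart q \<and> pathfinish p = pathfinish q \<longrightarrow> homotopic_paths UNIV p q)"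

lemma relatively_simply_connected_subset:
  assumes "relatively_simply_connected V" "W \<subseteq> V"
  shows "relatively_simply_connected W"
  unfolding relatively_simply_connected_def
proof (intro allI impI, elim conjE)
  fix p q assume "path p" "path q" "path_image p \<subseteq> W" "path_image q \<subseteq> W"
    "pathstart p = pathstart q" "pathfinish p = pathfinish q"
  with assms show "homotopic_paths UNIV p q"
    unfolding relatively_simply_connected_def by (metis order_trans)
qed

definition elementary :: "'a::topological_space set \<Rightarrow> bool" where
  "elementary V \<longleftrightarrow> open V \<and> path_connected V \<and> relatively_simply_connected V"

text \<open>The semilocal condition only concerns loops at one point \<open>x\<close>. On a path connected
  neighbourhood it extends to all pairs of paths with the same ends, because every loop is
  conjugate to one at \<open>x\<close>.\<close>

lemma elementary_neighbourhood:
  assumes "poincare_space (UNIV :: 'a::topological_space set)" "open W" "(x::'a) \<in> W"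
  obtains V where "elementary V" "x \<in> V" "V \<subseteq> W"
proof -
  obtain U where U: "open U" "x \<in> U" and null: "\<And>c. path c \<Longrightarrow> path_image c \<subseteq> U \<Longrightarrow> pathstart c = x \<Longrightarrow>
      pathfinish c = x \<Longrightarrow> homotopic_paths UNIV c (\<lambda>_. x)"
    using assms(1) unfolding poincare_space_def semilocally_simply_connected_def
    by (metis UNIV_I open_openin openin_subtopology_self subtopology_UNIV)
  obtain V where V: "open V" "path_connected V" "x \<in> V" "V \<subseteq> U \<inter> W"
  proof -
    have "locally path_connected (UNIV :: 'a set)" "openin (top_of_set UNIV) (U \<inter> W)"
      using assms U by (auto simp: poincare_space_def)
    then show thesis
      using that U assms(3) unfolding locally_path_connected
      by (metis IntI open_openin subtopology_UNIV)
  qed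
  have "homotopic_paths UNIV p q"
    if p: "path p" "path_image p \<subseteq> V" and q: "path q" "path_image q \<subseteq> V"
      and ends: "pathstart p = pathstart q" "pathfinish p = pathfinish q" for p q
  proof -
    have "pathstart p \<in> V" using p pathstart_in_path_image by blast
    then obtain r where r: "path r" "path_image r \<subseteq> V" "pathstart r = x" "pathfinish r = pathstart p"
      using V unfolding path_connected_def by blast
    have "path_image p \<subseteq> U" "path_image q \<subseteq> U" "path_image r \<subseteq> U" using p q r V by auto
    then have "homotopic_paths UNIV ((r +++ p) +++ reversepath (r +++ q)) (\<lambda>_. pathstart (r +++ p))"
      using p q r ends null[of "(r +++ p) +++ reversepath (r +++ q)"]
      by (simp add: path_image_join)
    then have "homotopic_paths UNIV (r +++ p) (r +++ q)"
      by (rule homotopic_paths_if_loop_null) (use p q r ends in auto)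
    then show ?thesis
      by (rule homotopic_paths_cancel_left) (use p q r ends in auto)
  qed
  then have "elementary V"
    using V by (auto simp: elementary_def relatively_simply_connected_def)
  then show thesis using that V by blast
qed

definition small_path :: "('a::topological_space \<times> 'a) set \<Rightarrow> (real \<Rightarrow> 'a) \<Rightarrow> 'a \<Rightarrow> 'a \<Rightarrow> bool" where
  "small_path F c x y \<longleftrightarrow> path c \<and> pathstart c = x \<and> pathfinish c = y \<and>
     (\<forall>u\<in>{0..1}. \<forall>v\<in>{0..1}. (c u, c v) \<in> F)"

lemma small_path_mono: "small_path F c x y \<Longrightarrow> F \<subseteq> E \<Longrightarrow> small_path E c x y"
  by (auto simp: small_path_def)

lemma small_path_ends: "small_path F c x y \<Longrightarrow> (x, y) \<in> F"
  by (auto simp: small_path_def pathstart_def pathfinish_def)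

lemma uniform_local_path_connectedness:
  assumes "compact (UNIV :: 'a::uniform_space set)" "poincare_space (UNIV :: 'a set)" "F \<in> entourages"
  obtains D where "D \<in> entourages" "D \<subseteq> F" "\<And>x y::'a. (x, y) \<in> D \<Longrightarrow> \<exists>c. small_path F c x y"
proof -
  obtain F' where F': "F' \<in> entourages" "F' O F' \<subseteq> F" using assms entourage_half by blast
  have "\<exists>V\<in>{V. path_connected V \<and> (\<exists>z. V \<subseteq> F' `` {z})}. open V \<and> x \<in> V" for x :: 'a
  proof -
    obtain W where "open W" "x \<in> W" "W \<subseteq> F' `` {x}" using F' open_subset_entourage_Image by blast
    then show ?thesis using elementary_neighbourhood[OF assms(2)] unfolding elementary_def
      by (metis (mono_tags, lifting) mem_Collect_eq order_trans)
  qed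
  then obtain D where D: "D \<in> entourages"
      "\<And>x::'a. \<exists>V\<in>{V. path_connected V \<and> (\<exists>z. V \<subseteq> F' `` {z})}. D `` {x} \<subseteq> V"
    using Lebesgue_entourage[OF assms(1)] by (metis (no_types, lifting))
  have D': "\<exists>c. small_path F c x y" if "(x, y) \<in> D" for x y
  proof -
    obtain V z where V: "path_connected V" "V \<subseteq> F' `` {z}" "D `` {x} \<subseteq> V" using D by blast
    have "x \<in> V" "y \<in> V" using V that entourage_refl[OF D(1)] by auto
    then obtain c where c: "path c" "path_image c \<subseteq> V" "pathstart c = x" "pathfinish c = y"
      using V unfolding path_connected_def by blast
    have "(c u, c v) \<in> F" if "u \<in> {0..1}" "v \<in> {0..1}" for u v
    proof -
      have "c u \<in> V" "c v \<in> V" using c(2) that by (auto simp: path_image_def)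
      then have "(z, c u) \<in> F'" "(z, c v) \<in> F'" using V(2) by auto
      then show ?thesis using F' entourage_sym by blast
    qed
    with c show ?thesis by (auto simp: small_path_def)
  qed
  then have "D \<subseteq> F" using small_path_ends by fast
  then show thesis using that D(1) D' by blast
qed

lemma uniform_semilocal_simple_connectedness:
  assumes "compact (UNIV :: 'a::uniform_space set)" "poincare_space (UNIV :: 'a set)"
  obtains E where "E \<in> entourages" "\<And>x::'a. relatively_simply_connected (E `` {x})"
proof -
  have "\<exists>V\<in>Collect elementary. open V \<and> x \<in> V" for x :: 'a
  proof -
    obtain V where "elementary V" "x \<in> V"
      by (rule elementary_neighbourhood[OF assms(2) open_UNIV UNIV_I])
    then show ?thesis unfolding elementary_def by blast
  qed
  then obtain E where E: "E \<in> entourages" "\<And>x::'a. \<exists>V\<in>Collect elementary. E `` {x} \<subseteq> V"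
    by (rule Lebesgue_entourage[OF assms(1)]) (rule that)
  have "relatively_simply_connected (E `` {x})" for x
  proof -
    obtain V where "elementary V" "E `` {x} \<subseteq> V" using E(2)[of x] by auto
    then show ?thesis
      using relatively_simply_connected_subset unfolding elementary_def by metis
  qed
  with E(1) show thesis by (rule that)
qed

section \<open>Realizing chains by paths\<close>

lemma path_image_small_path: "small_path F c x y \<Longrightarrow> path_image c \<subseteq> F `` {x}"
  by (auto simp: small_path_def path_image_def pathstart_def)

lemma small_path_const: "(x, x) \<in> F \<Longrightarrow> small_path F (\<lambda>_. x) x x"
  by (auto simp: small_path_def path_def pathstart_def pathfinish_def)

text \<open>The scale at which chains can be turned into paths: \<open>D\<^sub>0\<close>-close points are joined by \<open>F\<^sub>0\<close>-small
  paths, and three such paths along a triangle, which stay in the \<open>(F\<^sub>0 O F\<^sub>0)\<close>-neighbourhood of a corner,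
  form a null-homotopic loop.\<close>

locale poincare_scale =
  fixes F\<^sub>0 D\<^sub>0 :: "('a::uniform_space \<times> 'a) set"
  assumes compact_space: "compact (UNIV :: 'a set)"
    and poincare: "poincare_space (UNIV :: 'a set)"
    and F\<^sub>0: "F\<^sub>0 \<in> entourages"
    and D\<^sub>0: "D\<^sub>0 \<in> entourages" "D\<^sub>0 \<subseteq> F\<^sub>0"
    and linked: "(x, y) \<in> D\<^sub>0 \<Longrightarrow> \<exists>c. small_path F\<^sub>0 c x y"
    and rigid: "relatively_simply_connected ((F\<^sub>0 O F\<^sub>0) `` {x})"

lemma poincare_scale_exists:
  assumes "compact (UNIV :: 'a::uniform_space set)" "poincare_space (UNIV :: 'a set)"
  obtains F D :: "('a::uniform_space \<times> 'a) set" where "poincare_scale F D"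
proof -
  obtain E :: "('a \<times> 'a) set" where E: "E \<in> entourages" "\<And>x. relatively_simply_connected (E `` {x})"
    by (rule uniform_semilocal_simple_connectedness[OF assms]) (rule that)
  obtain F where F: "F \<in> entourages" "F O F \<subseteq> E"
    by (rule entourage_half[OF E(1)]) (rule that)
  obtain D where D: "D \<in> entourages" "D \<subseteq> F" "\<And>x y. (x, y) \<in> D \<Longrightarrow> \<exists>c. small_path F c x y"
    by (rule uniform_local_path_connectedness[OF assms F(1)]) (rule that)
  have "relatively_simply_connected ((F O F) `` {x})" for x
    by (rule relatively_simply_connected_subset[OF E(2)]) (use F(2) in blast)
  then have "poincare_scale F D"
    using assms F(1) D by unfold_locales
  then show thesis by (rule that)
qed

context poincare_scale
begin

lemma small_path_triangle:
  assumes p: "small_path F\<^sub>0 p x y" and q: "small_path F\<^sub>0 q y z" and r: "small_path F\<^sub>0 r x z"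
  shows "homotopic_paths UNIV (p +++ q) r"
proof -
  have xy: "(x, y) \<in> F\<^sub>0" using small_path_ends[OF p] .
  have "path_image p \<subseteq> (F\<^sub>0 O F\<^sub>0) `` {x}" "path_image r \<subseteq> (F\<^sub>0 O F\<^sub>0) `` {x}"
    using path_image_small_path[OF p] path_image_small_path[OF r] entourage_refl[OF F\<^sub>0] by blast+
  moreover have "path_image q \<subseteq> (F\<^sub>0 O F\<^sub>0) `` {x}"
    using path_image_small_path[OF q] xy by blast
  ultimately show ?thesis
    using rigid[of x] p q r unfolding relatively_simply_connected_def small_path_def
    by (simp add: path_image_join)
qed

lemma small_path_unique:
  assumes p: "small_path F\<^sub>0 p x y" and q: "small_path F\<^sub>0 q x y"
  shows "homotopic_paths UNIV p q"
proof -
  have "small_path F\<^sub>0 (\<lambda>_. x) x x" using small_path_const entourage_refl[OF F\<^sub>0] by blast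
  from small_path_triangle[OF this p q] have "homotopic_paths UNIV ((\<lambda>_. x) +++ p) q" .
  moreover have "homotopic_paths UNIV ((\<lambda>_. x) +++ p) p"
    using homotopic_paths_const_left[of p] p by (auto simp: small_path_def)
  ultimately show ?thesis by (rule homotopic_paths_trans[OF homotopic_paths_sym, rotated])
qed

definition link :: "'a \<Rightarrow> 'a \<Rightarrow> real \<Rightarrow> 'a" where
  "link x y = (SOME c. small_path F\<^sub>0 c x y)"

lemma link_small: "(x, y) \<in> D\<^sub>0 \<Longrightarrow> small_path F\<^sub>0 (link x y) x y"
  unfolding link_def by (rule someI_ex[OF linked])

lemma link_path [simp]:
  assumes "(x, y) \<in> D\<^sub>0"
  shows "path (link x y)" "pathstart (link x y) = x" "pathfinish (link x y) = y"
  using link_small[OF assms] by (auto simp: small_path_def)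

fun realize :: "'a list \<Rightarrow> real \<Rightarrow> 'a" where
  "realize [] = (\<lambda>_. undefined)"
| "realize [x] = (\<lambda>_. x)"
| "realize (x # y # xs) = link x y +++ realize (y # xs)"

lemma realize_path:
  "is_chain D\<^sub>0 p q xs \<Longrightarrow> path (realize xs) \<and> pathstart (realize xs) = p \<and> pathfinish (realize xs) = q"
proof (induction xs arbitrary: p rule: realize.induct)
  case (2 x)
  then show ?case by (auto simp: path_def pathstart_def pathfinish_def)
next
  case (3 x y xs)
  then show ?case by (auto simp: is_chain_Cons)
qed (auto simp: is_chain_def)

lemma realize_append:
  assumes "is_chain D\<^sub>0 p y (xs @ [y])" "is_chain D\<^sub>0 y q (y # zs)"
  shows "homotopic_paths UNIV (realize (xs @ y # zs)) (realize (xs @ [y]) +++ realize (y # zs))"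
  using assms(1)
proof (induction xs arbitrary: p)
  case Nil
  note R = realize_path[OF assms(2)]
  show ?case
    using homotopic_paths_sym[OF homotopic_paths_const_left[of "realize (y # zs)"]] R by simp
next
  case (Cons x xs)
  note R = realize_path[OF assms(2)]
  show ?case
  proof (cases xs)
    case Nil
    with Cons.prems have xy: "(x, y) \<in> D\<^sub>0" by (simp add: is_chain_Cons)
    have "homotopic_paths UNIV ((link x y +++ (\<lambda>_. y)) +++ realize (y # zs)) (link x y +++ realize (y # zs))"
    proof (rule homotopic_paths_join)
      show "homotopic_paths UNIV (link x y +++ (\<lambda>_. y)) (link x y)"
        using homotopic_paths_const_right[of "link x y"] xy by simp
    qed (use R xy in \<open>auto simp: pathfinish_def[of "\<lambda>_. y"]\<close>)
    then show ?thesis using Nil by (simp add: homotopic_paths_sym)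
  next
    case (Cons w ws)
    with Cons.prems have xw: "(x, w) \<in> D\<^sub>0" and c: "is_chain D\<^sub>0 w y (xs @ [y])"
      by (simp_all add: is_chain_Cons)
    let ?A = "realize (xs @ [y])" and ?B = "realize (y # zs)"
    have "homotopic_paths UNIV (link x w +++ realize (xs @ y # zs)) (link x w +++ (?A +++ ?B))"
      by (rule homotopic_paths_join[OF _ Cons.IH[OF c]])
        (use xw homotopic_paths_imp_pathstart[OF Cons.IH[OF c]] realize_path[OF c] in auto)
    also have "homotopic_paths UNIV (link x w +++ (?A +++ ?B)) ((link x w +++ ?A) +++ ?B)"
      by (rule homotopic_paths_sym[OF homotopic_paths_assoc_UNIV])
        (use xw realize_path[OF c] R in auto)
    finally show ?thesis using Cons by simp
  qed
qed

text \<open>Between two points of the chain the new point spans a small triangle; at an end of the chain it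
  must repeat the end point, so that the new link is a small loop.\<close>

lemma realize_insert:
  assumes "is_chain D\<^sub>0 p q (xs @ zs)" "is_chain D\<^sub>0 p q (xs @ y # zs)"
  shows "homotopic_paths UNIV (realize (xs @ y # zs)) (realize (xs @ zs))"
  using assms
proof (induction xs arbitrary: p)
  case Nil
  then obtain zs' where zs: "zs = p # zs'" "y = p" by (cases zs) (auto simp: is_chain_def)
  have pp: "(p, p) \<in> D\<^sub>0" using entourage_refl[OF D\<^sub>0(1)] .
  have R: "path (realize zs)" "pathstart (realize zs) = p" using realize_path Nil(1) by auto
  have "homotopic_paths UNIV (link p p +++ realize zs) ((\<lambda>_. p) +++ realize zs)"
  proof (rule homotopic_paths_join)
    show "homotopic_paths UNIV (link p p) (\<lambda>_. p)"
      by (rule small_path_unique[OF link_small[OF pp] small_path_const]) (rule entourage_refl[OF F\<^sub>0])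
  qed (use R pp in auto)
  also have "homotopic_paths UNIV ((\<lambda>_. p) +++ realize zs) (realize zs)"
    using homotopic_paths_const_left[OF R(1)] R by simp
  finally show ?case using zs by simp
next
  case (Cons x xs)
  show ?case
  proof (cases xs)
    case Nil
    show ?thesis
    proof (cases zs)
      case zs: Nil
      have xx: "(x, x) \<in> D\<^sub>0" using entourage_refl[OF D\<^sub>0(1)] .
      have "homotopic_paths UNIV (link x x +++ (\<lambda>_. x)) (link x x)"
        using homotopic_paths_const_right[of "link x x"] xx by simp
      also have "homotopic_paths UNIV (link x x) (\<lambda>_. x)"
        by (rule small_path_unique[OF link_small[OF xx] small_path_const]) (rule entourage_refl[OF F\<^sub>0])
      finally show ?thesis using Cons.prems Nil zs by (simp add: is_chain_Cons)
    next
      case zs: (Cons z zs')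
      have xz: "(x, z) \<in> D\<^sub>0" "(x, y) \<in> D\<^sub>0" "(y, z) \<in> D\<^sub>0" and c: "is_chain D\<^sub>0 z q (z # zs')"
        using Cons.prems Nil zs by (auto simp: is_chain_Cons)
      let ?R = "realize (z # zs')"
      have R: "path ?R" "pathstart ?R = z" using realize_path[OF c] by auto
      have "homotopic_paths UNIV (link x y +++ (link y z +++ ?R)) ((link x y +++ link y z) +++ ?R)"
        by (rule homotopic_paths_sym[OF homotopic_paths_assoc_UNIV]) (use xz R in auto)
      also have "homotopic_paths UNIV ((link x y +++ link y z) +++ ?R) (link x z +++ ?R)"
        by (rule homotopic_paths_join)
          (use small_path_triangle[OF link_small link_small link_small] xz R in auto)
      finally show ?thesis using Nil zs by simp
    qed
  next
    case xs: (Cons w ws)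
    have xw: "(x, w) \<in> D\<^sub>0" and c: "is_chain D\<^sub>0 w q (xs @ zs)" "is_chain D\<^sub>0 w q (xs @ y # zs)"
      using Cons.prems xs by (auto simp: is_chain_Cons)
    have "homotopic_paths UNIV (link x w +++ realize (xs @ y # zs)) (link x w +++ realize (xs @ zs))"
      by (rule homotopic_paths_join[OF _ Cons.IH[OF c]]) (use xw realize_path[OF c(2)] in auto)
    then show ?thesis using xs by simp
  qed
qed

lemma realize_homotopic:
  assumes "chain_homotopic D\<^sub>0 \<alpha> \<beta>" "is_chain D\<^sub>0 p q \<alpha>"
  shows "homotopic_paths UNIV (realize \<alpha>) (realize \<beta>)"
  using assms(1)
proof (induction rule: equivclp_induct)
  case base
  then show ?case using realize_path[OF assms(2)] by simp
next
  case (step \<beta> \<gamma>)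
  have "homotopic_paths UNIV (realize \<delta>) (realize \<epsilon>)" if "add_point D\<^sub>0 \<epsilon> \<delta>" for \<delta> \<epsilon>
    using that realize_insert unfolding add_point_def by blast
  then have "homotopic_paths UNIV (realize \<beta>) (realize \<gamma>)"
    using step(2) homotopic_paths_sym by blast
  with step(3) show ?case by (rule homotopic_paths_trans)
qed

lemma realize_samples_aux:
  assumes "path c" "set (t # ts) \<subseteq> {0..1}"
    and "successively (\<lambda>s t. s \<le> t \<and> (\<forall>u\<in>{s..t}. \<forall>v\<in>{s..t}. (c u, c v) \<in> D\<^sub>0)) (t # ts)"
  shows "homotopic_paths UNIV (realize (map c (t # ts))) (c \<circ> linepath t (last (t # ts)))"
  using assms(2,3)
proof (induction ts arbitrary: t)
  case Nil
  have "c \<circ> linepath t t = (\<lambda>_. c t)" by (auto simp: linepath_def algebra_simps)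
  then show ?case by (simp add: path_def)
next
  case (Cons s ts)
  let ?l = "last (s # ts)"
  have c: "continuous_on {0..1} c" using assms(1) by (simp add: path_def)
  have st: "t \<in> {0..1}" "s \<in> {0..1}" "?l \<in> {0..1}"
    using Cons.prems(1) last_in_set[of "s # ts"] by auto
  note conv = convex_closed_interval[of "0::real" 1, unfolded cbox_interval]
  have small: "\<forall>u\<in>{t..s}. \<forall>v\<in>{t..s}. (c u, c v) \<in> D\<^sub>0" and ts: "t \<le> s" using Cons.prems(2) by auto
  have lin: "linepath t s u \<in> {t..s}" if "u \<in> {0..1}" for u
    using that linepath_in_path[of u t s] ts by (simp add: closed_segment_eq_real_ivl)
  have piece: "small_path F\<^sub>0 (c \<circ> linepath t s) (c t) (c s)"
    using path_comp_linepath[OF c conv st(1,2)] small lin D\<^sub>0(2)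
    unfolding small_path_def by (simp add: subset_iff)
  have "(c t, c s) \<in> D\<^sub>0" using small ts by auto
  then have "homotopic_paths UNIV (link (c t) (c s)) (c \<circ> linepath t s)"
    using small_path_unique link_small piece by blast
  then have "homotopic_paths UNIV (link (c t) (c s) +++ realize (map c (s # ts)))
      ((c \<circ> linepath t s) +++ (c \<circ> linepath s ?l))"
  proof (rule homotopic_paths_join)
    show IH: "homotopic_paths UNIV (realize (map c (s # ts))) (c \<circ> linepath s ?l)"
      using Cons.prems by (intro Cons.IH) auto
    show "pathfinish (link (c t) (c s)) = pathstart (realize (map c (s # ts)))"
      using homotopic_paths_imp_pathstart[OF IH] \<open>(c t, c s) \<in> D\<^sub>0\<close> by (simp add: pathstart_compose)
  qed
  also have "homotopic_paths UNIV ((c \<circ> linepath t s) +++ (c \<circ> linepath s ?l)) (c \<circ> linepath t ?l)"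
    by (rule homotopic_paths_join_linepaths[OF c conv]) (rule st)+
  finally show ?case unfolding list.map realize.simps last_ConsR[OF list.distinct(2)] .
qed

text \<open>Each piece of the path on a fine partition is a small path, hence homotopic to the link with the
  same ends.\<close>

lemma realize_samples:
  assumes "path c" "fine_partition D\<^sub>0 c ts"
  shows "homotopic_paths UNIV (realize (map c ts)) c"
proof -
  obtain us where ts: "ts = 0 # us" using fine_partition_ends[OF assms(2)] by auto
  have "set ts \<subseteq> {0..1}" using fine_partition_bounds[OF assms(2)] by auto
  then show ?thesis
    using realize_samples_aux[of c 0 us] assms unfolding ts fine_partition_def
    by (simp add: comp_linepath_0_1)
qed

text \<open>The links themselves are only \<open>F\<^sub>0\<close>-small and need not trace the given chain at a finer scale \<open>F\<close>.
  If neighbours in the chain are close enough to be joined by \<open>F\<close>-small paths, then using those instead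
  does not change the homotopy class of the realization.\<close>

lemma realize_traced:
  assumes F: "F \<in> entourages" "F \<subseteq> F\<^sub>0" and D: "D \<subseteq> F" "D \<subseteq> D\<^sub>0"
    and D_linked: "\<And>x y. (x, y) \<in> D \<Longrightarrow> \<exists>c. small_path F c x y"
    and "is_chain D p q xs"
  shows "\<exists>c ts. homotopic_paths UNIV (realize xs) c \<and> fine_partition F c ts \<and>
                chain_homotopic F xs (map c ts)"
  using assms(6)
proof (induction xs arbitrary: p rule: realize.induct)
  case 1
  then show ?case by (simp add: is_chain_def)
next
  case (2 x)
  have xx: "(x, x) \<in> F" using entourage_refl[OF F(1)] .
  then have "fine_partition F (\<lambda>_. x) [0, 1]" by (intro fine_partition_unit)
  moreover have "chain_homotopic F [x] (map (\<lambda>_. x) [0, 1::real])"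
    using chain_homotopic_repeat_hd[of F x x x "[]"] xx by simp
  moreover have "homotopic_paths UNIV (realize [x]) (\<lambda>_. x)"
    by (simp add: path_def)
  ultimately show ?case by blast
next
  case (3 x y xs)
  then have xy: "(x, y) \<in> D" and yxs: "is_chain D y q (y # xs)" by (auto simp: is_chain_Cons)
  obtain c ts where c: "homotopic_paths UNIV (realize (y # xs)) c" "fine_partition F c ts"
      "chain_homotopic F (y # xs) (map c ts)"
    using "3.IH"[OF yxs] by blast
  obtain e where e: "small_path F e x y" using D_linked[OF xy] by blast
  have xy0: "(x, y) \<in> D\<^sub>0" using xy D by blast
  have yxs': "is_chain D\<^sub>0 y q (y # xs)" by (rule is_chain_mono[OF yxs D(2)])
  have start: "pathstart c = y"
    using homotopic_paths_imp_pathstart[OF c(1)] realize_path[OF yxs'] by simp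
  have "fine_partition F e [0, 1]"
    using e unfolding small_path_def by (intro fine_partition_unit) blast
  moreover have "e 1 = c 0"
    using e start unfolding small_path_def by (simp add: pathstart_def pathfinish_def)
  ultimately obtain vs where vs: "fine_partition F (e +++ c) vs"
      "map (e +++ c) vs = map e [0, 1] @ tl (map c ts)"
    by (rule fine_partition_join[OF _ c(2)]) (rule that)
  have "map e [0, 1] @ tl (map c ts) = x # map c ts"
  proof -
    obtain us where "ts = 0 # us" using fine_partition_ends[OF c(2)] by auto
    then show ?thesis
      using e \<open>e 1 = c 0\<close> unfolding small_path_def by (simp add: pathstart_def)
  qed
  moreover have "chain_homotopic F (x # y # xs) (x # map c ts)"
    by (rule chain_homotopic_Cons[OF c(3) is_chain_mono[OF yxs D(1)]]) (use xy D in blast)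
  moreover have "homotopic_paths UNIV (realize (x # y # xs)) (e +++ c)"
    unfolding realize.simps
  proof (rule homotopic_paths_join[OF _ c(1)])
    show "homotopic_paths UNIV (link x y) e"
      by (rule small_path_unique[OF link_small[OF xy0] small_path_mono[OF e F(2)]])
    show "pathfinish (link x y) = pathstart (realize (y # xs))"
      using xy0 realize_path[OF yxs'] by simp
  qed
  ultimately show ?case using vs by metis
qed

end

section \<open>Paths as points of the inverse limit\<close>

text \<open>The end point of the lift of \<open>c\<close> to the inverse limit: the coherent family of classes of
  chains sampled from \<open>c\<close>.\<close>

definition lift_end :: "(real \<Rightarrow> 'a::uniform_space) \<Rightarrow> ('a \<times> 'a) set \<Rightarrow> 'a list set" where
  "lift_end c = (\<lambda>E\<in>entourages. chain_class E (map c (SOME ts. fine_partition E c ts)))"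

lemma lift_end_eq:
  assumes "E \<in> entourages" "fine_partition E c ts"
  shows "lift_end c E = chain_class E (map c ts)"
proof -
  have "fine_partition E c (SOME ts. fine_partition E c ts)" using assms(2) by (rule someI)
  from fine_partition_unique[OF this assms(2)] show ?thesis
    using assms(1) by (simp add: lift_end_def chain_class_eq_iff)
qed

lemma lift_end_homotopic:
  assumes "homotopic_paths UNIV c d"
  shows "lift_end c = lift_end d"
proof
  fix E
  show "lift_end c E = lift_end d E"
  proof (cases "E \<in> entourages")
    case True
    have cd: "path c" "path d" using homotopic_paths_imp_path[OF assms] by auto
    obtain ts where ts: "fine_partition E c ts" by (rule fine_partition_exists[OF cd(1) True])
    obtain us where us: "fine_partition E d us" by (rule fine_partition_exists[OF cd(2) True])
    show ?thesis
      using homotopic_paths_imp_chain_homotopic[OF assms True ts us]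
      by (simp add: lift_end_eq[OF True ts] lift_end_eq[OF True us] chain_class_eq_iff)
  qed (simp add: lift_end_def)
qed

lemma bonding_chain_class:
  assumes "F \<subseteq> E"
  shows "bonding E (chain_class F \<alpha>) = chain_class E \<alpha>"
proof -
  have "chain_class E \<beta> = chain_class E \<alpha>" if "\<beta> \<in> chain_class F \<alpha>" for \<beta>
    unfolding chain_class_eq_iff
    by (rule equivclp_sym, rule chain_homotopic_mono[OF _ assms]) (use that in \<open>simp add: chain_class_def\<close>)
  moreover have "\<alpha> \<in> chain_class F \<alpha>" by (simp add: chain_class_def)
  ultimately show ?thesis unfolding bonding_def by blast
qed

lemma lift_end_in_Xtilde:
  assumes "path c" "pathstart c = b"
  shows "lift_end c \<in> Xtilde b"
proof -
  have ts: "\<exists>ts. fine_partition E c ts" if "E \<in> entourages" for E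
    by (rule fine_partition_exists[OF assms(1) that]) (rule exI)
  have "lift_end c E \<in> chain_space b E" if E: "E \<in> entourages" for E
  proof -
    obtain ts where "fine_partition E c ts" using ts[OF E] by blast
    from lift_end_eq[OF E this] fine_partition_chain[OF this] show ?thesis
      using assms(2) unfolding chain_space_def by (auto simp: pathstart_def)
  qed
  moreover have "bonding E (lift_end c F) = lift_end c E"
    if E: "E \<in> entourages" and F: "F \<in> entourages" "F \<subseteq> E" for E F
  proof -
    obtain ts where ts: "fine_partition F c ts" using ts[OF F(1)] by blast
    show ?thesis
      using lift_end_eq[OF F(1) ts] lift_end_eq[OF E fine_partition_mono[OF ts F(2)]]
      by (simp add: bonding_chain_class[OF F(2)])
  qed
  moreover have "lift_end c \<in> extensional entourages" by (simp add: lift_end_def)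
  ultimately show ?thesis by (auto simp: Xtilde_def PiE_def)
qed

lemma lift_end_const: "lift_end (\<lambda>_. b) = Xtilde_base b"
proof
  fix E :: "('a \<times> 'a) set"
  show "lift_end (\<lambda>_. b) E = Xtilde_base b E"
  proof (cases "E \<in> entourages")
    case True
    have bb: "(b, b) \<in> E" using entourage_refl[OF True] .
    then have "fine_partition E (\<lambda>_. b) [0, 1]" by (intro fine_partition_unit)
    from lift_end_eq[OF True this] have "lift_end (\<lambda>_. b) E = chain_class E [b, b]" by simp
    also have "\<dots> = chain_class E [b]"
      unfolding chain_class_eq_iff
      by (rule equivclp_sym, rule chain_homotopic_repeat_hd[of E b b]) (use bb in simp_all)
    finally show ?thesis using True by (simp add: Xtilde_base_def)
  qed (simp add: lift_end_def Xtilde_base_def)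
qed

lemma last_chain_class:
  assumes "is_chain E p q \<alpha>"
  shows "last ` chain_class E \<alpha> = {q}"
proof -
  have "last \<beta> = q" if "\<beta> \<in> chain_class E \<alpha>" for \<beta>
    using chain_homotopic_preserves[OF _ assms, of \<beta>] that by (auto simp: chain_class_def is_chain_def)
  moreover have "\<alpha> \<in> chain_class E \<alpha>" by (simp add: chain_class_def)
  ultimately show ?thesis by blast
qed

lemma Xtilde_proj_lift_end:
  assumes "path c"
  shows "Xtilde_proj (lift_end c) = pathfinish c"
proof -
  have "fine_partition UNIV c [0, 1]" by (rule fine_partition_unit) simp
  from lift_end_eq[OF entourage_UNIV this] last_chain_class[OF fine_partition_chain[OF this]]
  show ?thesis by (simp add: Xtilde_proj_def pathfinish_def)
qed

context poincare_scale
begin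

lemma lift_end_inject:
  assumes "path c" "path d" "lift_end c D\<^sub>0 = lift_end d D\<^sub>0"
  shows "homotopic_paths UNIV c d"
proof -
  obtain ts where ts: "fine_partition D\<^sub>0 c ts" by (rule fine_partition_exists[OF assms(1) D\<^sub>0(1)])
  obtain us where us: "fine_partition D\<^sub>0 d us" by (rule fine_partition_exists[OF assms(2) D\<^sub>0(1)])
  have "chain_homotopic D\<^sub>0 (map c ts) (map d us)"
    using assms(3) lift_end_eq[OF D\<^sub>0(1) ts] lift_end_eq[OF D\<^sub>0(1) us] by (simp add: chain_class_eq_iff)
  from realize_homotopic[OF this fine_partition_chain[OF ts]]
  have "homotopic_paths UNIV (realize (map c ts)) (realize (map d us))" .
  with realize_samples[OF assms(1) ts] realize_samples[OF assms(2) us] show ?thesis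
    by (blast intro: homotopic_paths_trans homotopic_paths_sym)
qed

lemma lift_end_eq_iff:
  fixes c d :: "real \<Rightarrow> 'a"
  assumes "path c" "path d"
  shows "lift_end c = lift_end d \<longleftrightarrow> homotopic_paths UNIV c d"
proof
  assume "lift_end c = lift_end d"
  then show "homotopic_paths UNIV c d" by (intro lift_end_inject[OF assms]) simp
qed (rule lift_end_homotopic)

text \<open>The realization \<open>g\<close> of the coordinate at \<open>D\<^sub>0\<close> represents the point. To check the coordinate at
  \<open>E\<close>, pass to a coordinate so fine that its chain is traced, up to homotopy at scale \<open>E\<close>, by some path;
  that path is homotopic to \<open>g\<close> because both coordinates agree at \<open>D\<^sub>0\<close>.\<close>

lemma lift_end_surj:
  fixes b :: 'a
  assumes x: "x \<in> Xtilde b"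
  obtains c where "path c" "pathstart c = b" "lift_end c = x"
proof -
  have x_chain: "\<exists>\<alpha> q. x E = chain_class E \<alpha> \<and> is_chain E b q \<alpha>" if "E \<in> entourages" for E
    using x that unfolding Xtilde_def chain_space_def by (fast dest: PiE_mem)
  have x_bond: "bonding E (x F) = x E" if "E \<in> entourages" "F \<in> entourages" "F \<subseteq> E" for E F
    using x that unfolding Xtilde_def by blast
  obtain \<alpha> q where \<alpha>: "x D\<^sub>0 = chain_class D\<^sub>0 \<alpha>" "is_chain D\<^sub>0 b q \<alpha>"
    using x_chain[OF D\<^sub>0(1)] by blast
  have "lift_end (realize \<alpha>) E = x E" if E: "E \<in> entourages" for E
  proof -
    have F: "E \<inter> F\<^sub>0 \<in> entourages" using E F\<^sub>0 entourage_Int by blast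
    obtain D where D: "D \<in> entourages" "D \<subseteq> E \<inter> F\<^sub>0"
        "\<And>x y. (x, y) \<in> D \<Longrightarrow> \<exists>c. small_path (E \<inter> F\<^sub>0) c x y"
      by (rule uniform_local_path_connectedness[OF compact_space poincare F]) (rule that)
    have D': "D \<inter> D\<^sub>0 \<in> entourages" using D(1) D\<^sub>0(1) by (rule entourage_Int)
    then obtain \<beta> r where \<beta>: "x (D \<inter> D\<^sub>0) = chain_class (D \<inter> D\<^sub>0) \<beta>" "is_chain (D \<inter> D\<^sub>0) b r \<beta>"
      using x_chain by blast
    have "chain_class D\<^sub>0 \<alpha> = chain_class D\<^sub>0 \<beta>"
      using x_bond[OF D\<^sub>0(1) D'] bonding_chain_class[of "D \<inter> D\<^sub>0" D\<^sub>0 \<beta>] \<alpha> \<beta> by simp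
    then have \<alpha>\<beta>: "homotopic_paths UNIV (realize \<alpha>) (realize \<beta>)"
      using realize_homotopic \<alpha>(2) by (simp add: chain_class_eq_iff)
    have "\<exists>c ts. homotopic_paths UNIV (realize \<beta>) c \<and> fine_partition (E \<inter> F\<^sub>0) c ts \<and>
                chain_homotopic (E \<inter> F\<^sub>0) \<beta> (map c ts)"
      by (rule realize_traced[OF F _ _ _ _ \<beta>(2)]) (use D in auto)
    then obtain c ts where c: "homotopic_paths UNIV (realize \<beta>) c" "fine_partition (E \<inter> F\<^sub>0) c ts"
        "chain_homotopic (E \<inter> F\<^sub>0) \<beta> (map c ts)" by blast
    have "lift_end (realize \<alpha>) E = lift_end c E"
      using lift_end_homotopic[OF \<alpha>\<beta>] lift_end_homotopic[OF c(1)] by simp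
    also have "\<dots> = chain_class E (map c ts)"
      by (rule lift_end_eq[OF E fine_partition_mono[OF c(2)]]) simp
    also have "\<dots> = chain_class E \<beta>"
      unfolding chain_class_eq_iff by (rule equivclp_sym, rule chain_homotopic_mono[OF c(3)]) simp
    also have "\<dots> = x E"
      using x_bond[OF E D'] bonding_chain_class[of "D \<inter> D\<^sub>0" E \<beta>] D(2) \<beta>(1) by auto
    finally show ?thesis .
  qed
  moreover have "x E = undefined" if "E \<notin> entourages" for E
  proof (rule PiE_arb[OF _ that])
    show "x \<in> (\<Pi>\<^sub>E E\<in>entourages. chain_space b E)"
      using x unfolding Xtilde_def mem_Collect_eq by (rule conjunct1)
  qed
  ultimately have "lift_end (realize \<alpha>) E = x E" for E
    by (cases "E \<in> entourages") (simp_all add: lift_end_def)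
  then have "lift_end (realize \<alpha>) = x" by (rule ext)
  then show thesis using that realize_path[OF \<alpha>(2)] by blast
qed

end

section \<open>The topology of the inverse limit\<close>

lemma star_rel_bonding:
  assumes "(A, B) \<in> star_rel b D D'" "D \<subseteq> E" "D' \<subseteq> E'"
  shows "(bonding E A, bonding E B) \<in> star_rel b E E'"
proof -
  obtain xs y z where *: "A = chain_class D (b # xs @ [y])" "B = chain_class D (b # xs @ [z])"
      "is_chain D b y (b # xs @ [y])" "is_chain D b z (b # xs @ [z])" "(y, z) \<in> D'"
    using assms(1) unfolding star_rel_def by blast
  have "is_chain E b y (b # xs @ [y])" "is_chain E b z (b # xs @ [z])" "(y, z) \<in> E'"
    using is_chain_mono[OF *(3) assms(2)] is_chain_mono[OF *(4) assms(2)] *(5) assms(3) by auto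
  then show ?thesis
    unfolding star_rel_def *(1,2) bonding_chain_class[OF assms(2)] by blast
qed

lemma Xtilde_star_rel_mono:
  assumes x: "x \<in> Xtilde b" and y: "y \<in> Xtilde b" and xy: "(x D, y D) \<in> star_rel b D D"
    and D: "D \<in> entourages" and E: "E \<in> entourages" and DE: "D \<subseteq> E" and D': "D \<subseteq> D'"
  shows "(x E, y E) \<in> star_rel b E D'"
proof -
  have "bonding E (x D) = x E" "bonding E (y D) = y E"
    using x y D E DE unfolding Xtilde_def by blast+
  with star_rel_bonding[OF xy DE D'] show ?thesis by simp
qed

text \<open>Because of the bonding maps, the single relation \<open>E\<^sup>*\<close> on the coordinate \<open>E\<close> suffices to
  describe the uniformity: relations \<open>D\<^sup>*\<close> with \<open>D\<close> smaller are subsumed by the coordinate \<open>D\<close>.\<close>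

lemma eventually_Xtilde_uniformity:
  "eventually P (Xtilde_uniformity b) \<longleftrightarrow>
   (\<exists>E\<in>entourages. \<forall>x\<in>Xtilde b. \<forall>y\<in>Xtilde b. (x E, y E) \<in> star_rel b E E \<longrightarrow> P (x, y))"
proof -
  define N where "N E = {(x, y). x \<in> Xtilde b \<and> y \<in> Xtilde b \<and> (x E, y E) \<in> star_rel b E E}" for E
  have "Xtilde_uniformity b = (INF E\<in>entourages. principal (N E))"
  proof (rule antisym)
    show "Xtilde_uniformity b \<le> (INF E\<in>entourages. principal (N E))"
    proof (rule INF_greatest)
      fix E :: "('a \<times> 'a) set" assume E: "E \<in> entourages"
      have "chain_uniformity b E \<le> principal (star_rel b E E)"
        unfolding chain_uniformity_def using E by (intro INF_lower) auto
      then have "filtercomap (\<lambda>(x, y). (x E, y E)) (chain_uniformity b E) \<le>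
          principal ((\<lambda>(x, y). (x E, y E)) -` star_rel b E E)"
        by (metis (no_types) filtercomap_mono filtercomap_principal)
      then have "Xtilde_uniformity b \<le>
          inf (principal (Xtilde b \<times> Xtilde b)) (principal ((\<lambda>(x, y). (x E, y E)) -` star_rel b E E))"
        unfolding Xtilde_uniformity_def by (rule inf_mono[OF order_refl INF_lower2[OF E]])
      also have "\<dots> \<le> principal (N E)"
        by (auto simp: N_def)
      finally show "Xtilde_uniformity b \<le> principal (N E)" .
    qed
    show "(INF E\<in>entourages. principal (N E)) \<le> Xtilde_uniformity b"
      unfolding Xtilde_uniformity_def chain_uniformity_def filtercomap_INF filtercomap_principal
    proof (intro inf_greatest INF_greatest)
      show "(INF E\<in>entourages. principal (N E)) \<le> principal (Xtilde b \<times> Xtilde b)"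
        by (rule INF_lower2[OF entourage_UNIV]) (auto simp: N_def)
      fix E D :: "('a \<times> 'a) set"
      assume E: "E \<in> entourages" and D: "D \<in> {D \<in> entourages. D \<subseteq> E}"
      then have "N D \<subseteq> (\<lambda>(x, y). (x E, y E)) -` star_rel b E D"
        using Xtilde_star_rel_mono[of _ b _ D E D] by (auto simp: N_def)
      then show "(INF E\<in>entourages. principal (N E)) \<le> principal ((\<lambda>(x, y). (x E, y E)) -` star_rel b E D)"
        using D by (intro INF_lower2[of D]) auto
    qed
  qed
  also have "eventually P \<dots> \<longleftrightarrow> (\<exists>E\<in>entourages. eventually P (principal (N E)))"
  proof (rule eventually_INF_base)
    fix E F :: "('a \<times> 'a) set" assume EF: "E \<in> entourages" "F \<in> entourages"
    have "N (E \<inter> F) \<subseteq> N E \<inter> N F"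
      using Xtilde_star_rel_mono[of _ b _ "E \<inter> F" E E] Xtilde_star_rel_mono[of _ b _ "E \<inter> F" F F]
        EF entourage_Int[OF EF]
      by (auto simp: N_def)
    then show "\<exists>D\<in>entourages. principal (N D) \<le> inf (principal (N E)) (principal (N F))"
      using entourage_Int[OF EF] by (intro bexI[of _ "E \<inter> F"]) simp_all
  qed (use entourage_UNIV in auto)
  finally show ?thesis by (auto simp: eventually_principal N_def)
qed

lemma openin_Xtilde_top:
  "openin (Xtilde_top b) A \<longleftrightarrow> A \<subseteq> Xtilde b \<and>
     (\<forall>x\<in>A. \<exists>E\<in>entourages. \<forall>y\<in>Xtilde b. (x E, y E) \<in> star_rel b E E \<longrightarrow> y \<in> A)"
proof (cases "A \<subseteq> Xtilde b")
  case True
  have "(\<forall>x'\<in>Xtilde b. \<forall>y\<in>Xtilde b. (x' E, y E) \<in> star_rel b E E \<longrightarrow> x' = x \<longrightarrow> y \<in> A) \<longleftrightarrow>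
        (\<forall>y\<in>Xtilde b. (x E, y E) \<in> star_rel b E E \<longrightarrow> y \<in> A)" if "x \<in> A" for x E
    using subsetD[OF True that] by auto
  then show ?thesis
    unfolding Xtilde_top_def openin_uniform_topology eventually_Xtilde_uniformity by simp
qed (simp add: Xtilde_top_def openin_uniform_topology)

text \<open>A path that is small enough has a partition without interior points. The chains must differ only in
  their last point, so the end of \<open>c\<close> is repeated in the chain of \<open>c\<close>.\<close>

lemma lift_end_extend_near:
  assumes c: "path c" "pathstart c = b" and d: "small_path E d (pathfinish c) z" and E: "E \<in> entourages"
  shows "(lift_end c E, lift_end (c +++ d) E) \<in> star_rel b E E"
proof -
  let ?y = "pathfinish c"
  obtain ts where ts: "fine_partition E c ts" by (rule fine_partition_exists[OF c(1) E])
  then obtain us where us: "ts = 0 # us @ [1]" using fine_partition_ends by blast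
  have map_c: "map c ts = b # map c us @ [?y]"
    using us c by (simp add: pathstart_def pathfinish_def)
  have "fine_partition E d [0, 1]"
    using d unfolding small_path_def by (intro fine_partition_unit) blast
  moreover have "c 1 = d 0"
    using d unfolding small_path_def by (simp add: pathstart_def pathfinish_def)
  ultimately obtain vs where vs: "fine_partition E (c +++ d) vs" "map (c +++ d) vs = map c ts @ tl (map d [0, 1])"
    by (rule fine_partition_join[OF ts]) (rule that)
  have yz: "(?y, z) \<in> E" "(?y, ?y) \<in> E" using small_path_ends[OF d] entourage_refl[OF E] by auto
  have map_cd: "map (c +++ d) vs = b # (map c us @ [?y]) @ [z]"
    using vs(2) map_c d unfolding small_path_def by (simp add: pathfinish_def)
  have chain: "is_chain E b ?y (b # map c us @ [?y])"
    using fine_partition_chain[OF ts] map_c c by (simp add: pathstart_def pathfinish_def)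
  have "is_chain E b ?y (b # (map c us @ [?y]) @ [?y])" "is_chain E b z (b # (map c us @ [?y]) @ [z])"
    using is_chain_join[OF chain, of ?y "[?y, ?y]"] is_chain_join[OF chain, of z "[?y, z]"] yz
    by (simp_all add: is_chain_Cons)
  moreover have "lift_end c E = chain_class E (b # (map c us @ [?y]) @ [?y])"
    using lift_end_eq[OF E ts] chain_homotopic_repeat_last[of E b ?y "b # map c us" ?y] chain yz map_c
    by (simp add: chain_class_eq_iff)
  moreover have "lift_end (c +++ d) E = chain_class E (b # (map c us @ [?y]) @ [z])"
    using lift_end_eq[OF E vs(1)] map_cd by simp
  ultimately show ?thesis
    using yz unfolding star_rel_def by blast
qed

text \<open>The points of the inverse limit reached from the end of the lift of \<open>c\<close> by lifting paths in \<open>V\<close>.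
  For elementary \<open>V\<close> that contain the end of \<open>c\<close> these are the sheets of the covering.\<close>

definition sheet :: "(real \<Rightarrow> 'a::uniform_space) \<Rightarrow> 'a set \<Rightarrow> (('a \<times> 'a) set \<Rightarrow> 'a list set) set" where
  "sheet c V = {lift_end (c +++ d) | d. path d \<and> pathstart d = pathfinish c \<and> path_image d \<subseteq> V}"

lemma sheet_cong:
  assumes "homotopic_paths UNIV c c'"
  shows "sheet c V = sheet c' V"
proof -
  have "lift_end (c +++ d) = lift_end (c' +++ d)" if "path d" "pathstart d = pathfinish c" for d
    using that assms by (intro lift_end_homotopic homotopic_paths_join) auto
  then show ?thesis
    using homotopic_paths_imp_pathfinish[OF assms] unfolding sheet_def by auto metis+
qed

lemma lift_end_in_sheet:
  assumes "path c" "pathfinish c \<in> V"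
  shows "lift_end c \<in> sheet c V"
proof -
  have "lift_end c = lift_end (c +++ (\<lambda>_. pathfinish c))"
    by (rule lift_end_homotopic[OF homotopic_paths_sym[OF homotopic_paths_const_right[OF assms(1)]]])
  then show ?thesis
    unfolding sheet_def using assms(2)
    by (auto intro!: exI[of _ "\<lambda>_. pathfinish c"] simp: path_def pathstart_def[of "\<lambda>_. pathfinish c"] path_image_def)
qed

lemma sheet_extend_subset:
  assumes "path c" "path d" "pathstart d = pathfinish c" "path_image d \<subseteq> V"
  shows "sheet (c +++ d) V \<subseteq> sheet c V"
proof
  fix x assume "x \<in> sheet (c +++ d) V"
  then obtain e where e: "x = lift_end ((c +++ d) +++ e)" "path e" "pathstart e = pathfinish d" "path_image e \<subseteq> V"
    unfolding sheet_def by auto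
  have "x = lift_end (c +++ (d +++ e))"
    unfolding e(1) by (rule lift_end_homotopic[OF homotopic_paths_assoc_UNIV]) (use assms e in auto)
  then show "x \<in> sheet c V"
    unfolding sheet_def using assms e by (auto intro!: exI[of _ "d +++ e"] simp: path_image_join)
qed

text \<open>A sheet may be based at any of its points, since a continuation inside \<open>V\<close> can be undone
  inside \<open>V\<close>.\<close>

lemma sheet_extend:
  assumes "path c" "path d" "pathstart d = pathfinish c" "path_image d \<subseteq> V"
  shows "sheet (c +++ d) V = sheet c V"
proof
  show "sheet (c +++ d) V \<subseteq> sheet c V" by (rule sheet_extend_subset[OF assms])
  have "homotopic_paths UNIV ((c +++ d) +++ reversepath d) (c +++ (d +++ reversepath d))"
    by (rule homotopic_paths_assoc_UNIV) (use assms in auto)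
  also have "homotopic_paths UNIV (c +++ (d +++ reversepath d)) (c +++ (\<lambda>_. pathfinish c))"
    by (rule homotopic_paths_join)
      (use homotopic_paths_reverse_right[OF assms(2)] assms in simp_all)
  also have "homotopic_paths UNIV (c +++ (\<lambda>_. pathfinish c)) c"
    by (rule homotopic_paths_const_right[OF assms(1)])
  finally have "sheet c V = sheet ((c +++ d) +++ reversepath d) V"
    by (rule sheet_cong[symmetric])
  also have "\<dots> \<subseteq> sheet (c +++ d) V"
    by (rule sheet_extend_subset) (use assms in auto)
  finally show "sheet c V \<subseteq> sheet (c +++ d) V" .
qed

lemma sheet_subset_Xtilde:
  assumes "path c" "pathstart c = b"
  shows "sheet c V \<subseteq> Xtilde b"
  unfolding sheet_def using assms by (auto intro!: lift_end_in_Xtilde)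

context poincare_scale
begin

lemma lift_end_realize:
  assumes c: "path c" and E: "E \<in> entourages" "E \<subseteq> D\<^sub>0" and \<alpha>: "lift_end c E = chain_class E \<alpha>"
  shows "homotopic_paths UNIV c (realize \<alpha>)"
proof -
  obtain ts where ts: "fine_partition E c ts" by (rule fine_partition_exists[OF c E(1)])
  have ts0: "fine_partition D\<^sub>0 c ts" by (rule fine_partition_mono[OF ts E(2)])
  have "chain_homotopic E (map c ts) \<alpha>"
    using lift_end_eq[OF E(1) ts] \<alpha> unfolding chain_class_eq_iff[symmetric] by simp
  then have "chain_homotopic D\<^sub>0 (map c ts) \<alpha>" by (rule chain_homotopic_mono[OF _ E(2)])
  from realize_homotopic[OF this fine_partition_chain[OF ts0]] show ?thesis
    by (rule homotopic_paths_trans[OF homotopic_paths_sym[OF realize_samples[OF c ts0]]])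
qed

text \<open>Conversely to \<open>lift_end_extend_near\<close>, every point close to the end of the lift of \<open>c\<close> is
  reached by continuing \<open>c\<close> along a small path: remove the last point of the common prefix.\<close>

lemma star_rel_extend:
  assumes F: "F \<subseteq> F\<^sub>0" and E: "E \<in> entourages" "E \<subseteq> D\<^sub>0"
    and E_linked: "\<And>x y. (x, y) \<in> E \<Longrightarrow> \<exists>d. small_path F d x y"
    and c: "path c" and h: "path h"
    and near: "(lift_end c E, lift_end h E) \<in> star_rel b E E"
  obtains d where "small_path F d (pathfinish c) (pathfinish h)" "homotopic_paths UNIV h (c +++ d)"
proof -
  obtain xs y z where *: "lift_end c E = chain_class E (b # xs @ [y])" "lift_end h E = chain_class E (b # xs @ [z])"
      "is_chain E b y (b # xs @ [y])" "is_chain E b z (b # xs @ [z])" "(y, z) \<in> E"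
    using near unfolding star_rel_def by blast
  have c_hom: "homotopic_paths UNIV c (realize (b # xs @ [y]))"
    and h_hom: "homotopic_paths UNIV h (realize (b # xs @ [z]))"
    by (rule lift_end_realize[OF c E *(1)], rule lift_end_realize[OF h E *(2)])
  have ch_y: "is_chain D\<^sub>0 b y (b # xs @ [y])" and ch_z: "is_chain D\<^sub>0 b z (b # xs @ [z])"
    and yz: "(y, z) \<in> D\<^sub>0"
    using is_chain_mono[OF *(3) E(2)] is_chain_mono[OF *(4) E(2)] *(5) E(2) by auto
  have ch_yz: "is_chain D\<^sub>0 y z [y, z]" using yz by (simp add: is_chain_Cons)
  have ends: "pathfinish c = y" "pathfinish h = z"
    using homotopic_paths_imp_pathfinish[OF c_hom] homotopic_paths_imp_pathfinish[OF h_hom]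
      realize_path[OF ch_y] realize_path[OF ch_z] by simp_all
  obtain d where d: "small_path F d y z" using E_linked[OF *(5)] by blast
  have d': "path d" "pathstart d = y" using d by (auto simp: small_path_def)
  have "is_chain D\<^sub>0 b z ((b # xs) @ y # [z])"
    using is_chain_join[OF ch_y ch_yz] by simp
  with ch_z have "homotopic_paths UNIV (realize ((b # xs) @ y # [z])) (realize ((b # xs) @ [z]))"
    by (intro realize_insert[of b z]) simp_all
  then have "homotopic_paths UNIV h (realize ((b # xs) @ y # [z]))"
    using h_hom homotopic_paths_sym homotopic_paths_trans by fastforce
  also have "homotopic_paths UNIV (realize ((b # xs) @ y # [z])) (realize ((b # xs) @ [y]) +++ realize [y, z])"
    by (rule realize_append[of b]) (use ch_y ch_yz in simp_all)
  also have "homotopic_paths UNIV (realize ((b # xs) @ [y]) +++ realize [y, z]) (c +++ d)"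
  proof (rule homotopic_paths_join)
    show "homotopic_paths UNIV (realize ((b # xs) @ [y])) c"
      using homotopic_paths_sym[OF c_hom] by simp
    have "homotopic_paths UNIV (realize [y, z]) (link y z)"
      using homotopic_paths_const_right[of "link y z"] yz by simp
    also have "homotopic_paths UNIV (link y z) d"
      by (rule small_path_unique[OF link_small[OF yz] small_path_mono[OF d F]])
    finally show "homotopic_paths UNIV (realize [y, z]) d" .
    show "pathfinish (realize ((b # xs) @ [y])) = pathstart (realize [y, z])"
      using realize_path[OF ch_y] realize_path[OF ch_yz] by simp
  qed
  finally show thesis using that d ends by simp
qed

text \<open>A point near the end of the lift of \<open>c +++ d\<close> arises by continuing along a path so small that it
  remains in the open set \<open>V\<close>.\<close>

lemma openin_sheet:
  fixes b :: 'a
  assumes c: "path c" "pathstart c = b" and V: "open V"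
  shows "openin (Xtilde_top b) (sheet c V)"
  unfolding openin_Xtilde_top
proof (intro conjI ballI)
  show "sheet c V \<subseteq> Xtilde b" by (rule sheet_subset_Xtilde[OF c])
  fix x assume "x \<in> sheet c V"
  then obtain d where d: "x = lift_end (c +++ d)" "path d" "pathstart d = pathfinish c" "path_image d \<subseteq> V"
    unfolding sheet_def by blast
  let ?v = "pathfinish d"
  have "?v \<in> V" using d(2,4) pathfinish_in_path_image by blast
  with V obtain E' where E': "E' \<in> entourages" "E' `` {?v} \<subseteq> V"
    by (rule entourage_Image_subset_open) (rule that)
  have F: "E' \<inter> F\<^sub>0 \<in> entourages" using E'(1) F\<^sub>0 by (rule entourage_Int)
  obtain D where D: "D \<in> entourages" "D \<subseteq> E' \<inter> F\<^sub>0"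
      "\<And>x y. (x, y) \<in> D \<Longrightarrow> \<exists>c. small_path (E' \<inter> F\<^sub>0) c x y"
    by (rule uniform_local_path_connectedness[OF compact_space poincare F]) (rule that)
  have D': "D \<inter> D\<^sub>0 \<in> entourages" using D(1) D\<^sub>0(1) by (rule entourage_Int)
  have cd: "path (c +++ d)" using c d by simp
  show "\<exists>E\<in>entourages. \<forall>y\<in>Xtilde b. (x E, y E) \<in> star_rel b E E \<longrightarrow> y \<in> sheet c V"
  proof (intro bexI[OF _ D'] ballI impI)
    fix y assume y: "y \<in> Xtilde b" and near: "(x (D \<inter> D\<^sub>0), y (D \<inter> D\<^sub>0)) \<in> star_rel b (D \<inter> D\<^sub>0) (D \<inter> D\<^sub>0)"
    obtain h where h: "path h" "pathstart h = b" "lift_end h = y"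
      by (rule lift_end_surj[OF y]) (rule that)
    obtain e where e: "small_path (E' \<inter> F\<^sub>0) e (pathfinish (c +++ d)) (pathfinish h)"
        "homotopic_paths UNIV h ((c +++ d) +++ e)"
      by (rule star_rel_extend[OF _ D' _ _ cd h(1), of "E' \<inter> F\<^sub>0" b])
        (use D(3) near d(1) h(3) that in auto)
    have e': "path e" "pathstart e = ?v" "path_image e \<subseteq> V"
      using e(1) path_image_small_path[OF e(1)] E'(2) by (auto simp: small_path_def)
    have "y \<in> sheet (c +++ d) V"
      unfolding sheet_def using e' lift_end_homotopic[OF e(2)] h(3) by auto
    then show "y \<in> sheet c V" using sheet_extend[OF c(1) d(2-4)] by simp
  qed
qed

text \<open>Inside the \<open>F\<close>-neighbourhood of the end of \<open>c\<close> all paths are \<open>(F O F)\<close>-small, so continuing \<open>c\<close> there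
  leads only to points that are close to the end of its lift.\<close>

lemma sheet_neighbourhood_base:
  fixes b :: 'a
  assumes A: "openin (Xtilde_top b) A" "lift_end c \<in> A" and c: "path c" "pathstart c = b"
    and W: "open W" "pathfinish c \<in> W"
  obtains V where "elementary V" "pathfinish c \<in> V" "V \<subseteq> W" "sheet c V \<subseteq> A"
proof -
  obtain E where E: "E \<in> entourages" "\<And>y. y \<in> Xtilde b \<Longrightarrow> (lift_end c E, y E) \<in> star_rel b E E \<Longrightarrow> y \<in> A"
    using A unfolding openin_Xtilde_top by blast
  obtain F where F: "F \<in> entourages" "F O F \<subseteq> E" by (rule entourage_half[OF E(1)]) (rule that)
  obtain U where U: "open U" "pathfinish c \<in> U" "U \<subseteq> F `` {pathfinish c}"
    by (rule open_subset_entourage_Image[OF F(1)]) (rule that)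
  obtain V where V: "elementary V" "pathfinish c \<in> V" "V \<subseteq> U \<inter> W"
    by (rule elementary_neighbourhood[OF poincare, of "U \<inter> W" "pathfinish c"]) (use U W that in auto)
  have "lift_end (c +++ d) \<in> A" if d: "path d" "pathstart d = pathfinish c" "path_image d \<subseteq> V" for d
  proof (rule E(2))
    show "lift_end (c +++ d) \<in> Xtilde b" using c d by (intro lift_end_in_Xtilde) auto
    have "(d u, d v) \<in> E" if "u \<in> {0..1}" "v \<in> {0..1}" for u v
    proof -
      have "d u \<in> V" "d v \<in> V" using d(3) that by (auto simp: path_image_def)
      then have "(pathfinish c, d u) \<in> F" "(pathfinish c, d v) \<in> F" using V(3) U(3) by auto
      then show ?thesis using F(2) entourage_sym[OF F(1)] by blast
    qed
    then have "small_path E d (pathfinish c) (pathfinish d)" using d by (simp add: small_path_def)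
    then show "(lift_end c E, lift_end (c +++ d) E) \<in> star_rel b E E"
      by (rule lift_end_extend_near[OF c _ E(1)])
  qed
  then have "sheet c V \<subseteq> A" unfolding sheet_def by blast
  with V show thesis using that by blast
qed

end

section \<open>The covering\<close>

lemma path_connected_poincare_space:
  assumes "poincare_space (UNIV :: 'a::topological_space set)"
  shows "path_connected (UNIV :: 'a set)"
proof -
  have "connected (UNIV :: 'a set)" "locally path_connected (UNIV :: 'a set)"
    using assms by (simp_all add: poincare_space_def)
  then show ?thesis
    by (simp add: path_connected_component connected_iff_connected_component path_component_eq_connected_component)
qed

lemma homotopic_paths_cancel_reverse:
  assumes "path r" "path s" "pathstart r = pathstart s"
  shows "homotopic_paths UNIV (r +++ (reversepath r +++ s)) s"
proof -
  have "homotopic_paths UNIV (r +++ (reversepath r +++ s)) ((r +++ reversepath r) +++ s)"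
    by (rule homotopic_paths_sym[OF homotopic_paths_assoc_UNIV]) (use assms in auto)
  also have "homotopic_paths UNIV ((r +++ reversepath r) +++ s) ((\<lambda>_. pathstart s) +++ s)"
    by (rule homotopic_paths_join) (use assms homotopic_paths_reverse_right[of r] in auto)
  also have "homotopic_paths UNIV ((\<lambda>_. pathstart s) +++ s) s"
    by (rule homotopic_paths_const_left[OF assms(2)])
  finally show ?thesis .
qed

context poincare_scale
begin

lemma sheets_disjoint:
  fixes c c' :: "real \<Rightarrow> 'a"
  assumes c: "path c" and c': "path c'" and x: "x \<in> sheet c V" "x \<in> sheet c' V"
  shows "sheet c V = sheet c' V"
proof -
  obtain d where d: "x = lift_end (c +++ d)" "path d" "pathstart d = pathfinish c" "path_image d \<subseteq> V"
    using x(1) unfolding sheet_def by blast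
  obtain d' where d': "x = lift_end (c' +++ d')" "path d'" "pathstart d' = pathfinish c'" "path_image d' \<subseteq> V"
    using x(2) unfolding sheet_def by blast
  have "homotopic_paths UNIV (c +++ d) (c' +++ d')"
    using lift_end_eq_iff[of "c +++ d" "c' +++ d'"] c c' d d' by simp
  from sheet_cong[OF this] show ?thesis
    using sheet_extend[OF c d(2-4)] sheet_extend[OF c' d'(2-4)] by simp
qed

lemma Xtilde_proj_sheet:
  assumes V: "path_connected V" and c: "path c" "pathfinish c \<in> V"
  shows "Xtilde_proj ` sheet c V = V"
proof -
  have proj: "Xtilde_proj (lift_end (c +++ d)) = pathfinish d" if "path d" "pathstart d = pathfinish c" for d
    using that c by (simp add: Xtilde_proj_lift_end)
  show ?thesis
  proof
    show "Xtilde_proj ` sheet c V \<subseteq> V"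
      unfolding sheet_def using proj pathfinish_in_path_image by fastforce
    show "V \<subseteq> Xtilde_proj ` sheet c V"
    proof
      fix v assume "v \<in> V"
      with V c obtain d where d: "path d" "path_image d \<subseteq> V" "pathstart d = pathfinish c" "pathfinish d = v"
        unfolding path_connected_def by blast
      then have "lift_end (c +++ d) \<in> sheet c V" unfolding sheet_def by blast
      then show "v \<in> Xtilde_proj ` sheet c V" using proj[OF d(1,3)] d(4) by force
    qed
  qed
qed

lemma continuous_map_Xtilde_proj:
  fixes b :: 'a
  shows "continuous_map (Xtilde_top b) euclidean Xtilde_proj"
  unfolding continuous_map_def
proof (intro conjI allI impI)
  fix U :: "'a set" assume "openin euclidean U"
  then have U: "open U" by simp
  have "\<exists>S. openin (Xtilde_top b) S \<and> x \<in> S \<and> S \<subseteq> {x \<in> topspace (Xtilde_top b). Xtilde_proj x \<in> U}"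
    if x: "x \<in> Xtilde b" "Xtilde_proj x \<in> U" for x
  proof -
    obtain c where c: "path c" "pathstart c = b" "lift_end c = x" by (rule lift_end_surj[OF x(1)]) (rule that)
    have "pathfinish c \<in> U" using x(2) Xtilde_proj_lift_end[OF c(1)] c(3) by simp
    then have "x \<in> sheet c U" using lift_end_in_sheet[OF c(1)] c(3) by simp
    moreover have "sheet c U \<subseteq> {x \<in> topspace (Xtilde_top b). Xtilde_proj x \<in> U}"
    proof -
      have "Xtilde_proj y \<in> U" if "y \<in> sheet c U" for y
      proof -
        obtain d where d: "y = lift_end (c +++ d)" "path d" "pathstart d = pathfinish c" "path_image d \<subseteq> U"
          using \<open>y \<in> sheet c U\<close> unfolding sheet_def by blast
        have "Xtilde_proj y = pathfinish d" using Xtilde_proj_lift_end[of "c +++ d"] c(1) d by simp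
        then show ?thesis using d(4) pathfinish_in_path_image[of d] by auto
      qed
      then show ?thesis using sheet_subset_Xtilde[OF c(1,2)] by (auto simp: topspace_Xtilde_top)
    qed
    ultimately show ?thesis using openin_sheet[OF c(1,2) U] by blast
  qed
  then show "openin (Xtilde_top b) {x \<in> topspace (Xtilde_top b). Xtilde_proj x \<in> U}"
    by (subst openin_subopen) (simp add: topspace_Xtilde_top)
qed simp

text \<open>Injectivity is triviality of loops in \<open>V\<close>; openness holds because the projection maps the smaller
  sheets, which form a base, onto open sets.\<close>

lemma homeomorphic_map_sheet:
  fixes b :: 'a
  assumes V: "elementary V" and c: "path c" "pathstart c = b" "pathfinish c \<in> V"
  shows "homeomorphic_map (subtopology (Xtilde_top b) (sheet c V)) (top_of_set V) Xtilde_proj"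
proof (rule bijective_open_imp_homeomorphic_map)
  let ?S = "sheet c V"
  have V': "open V" "path_connected V" "relatively_simply_connected V" using V by (auto simp: elementary_def)
  have S: "openin (Xtilde_top b) ?S" by (rule openin_sheet[OF c(1,2) V'(1)])
  have top: "topspace (subtopology (Xtilde_top b) ?S) = ?S"
    using openin_subset[OF S] by (auto simp: topspace_subtopology)
  have image: "Xtilde_proj ` ?S = V" by (rule Xtilde_proj_sheet[OF V'(2) c(1,3)])
  show "continuous_map (subtopology (Xtilde_top b) ?S) (top_of_set V) Xtilde_proj"
    using continuous_map_Xtilde_proj image top
    by (auto simp: continuous_map_in_subtopology continuous_map_from_subtopology)
  show "Xtilde_proj ` topspace (subtopology (Xtilde_top b) ?S) = topspace (top_of_set V)"
    using image top by simp
  show "inj_on Xtilde_proj (topspace (subtopology (Xtilde_top b) ?S))"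
    unfolding top
  proof (rule inj_onI)
    fix x y assume "x \<in> ?S" "y \<in> ?S" and xy: "Xtilde_proj x = Xtilde_proj y"
    then obtain d e where d: "x = lift_end (c +++ d)" "path d" "pathstart d = pathfinish c" "path_image d \<subseteq> V"
      and e: "y = lift_end (c +++ e)" "path e" "pathstart e = pathfinish c" "path_image e \<subseteq> V"
      unfolding sheet_def by blast
    have "pathfinish d = pathfinish e"
      using xy d e c by (simp add: Xtilde_proj_lift_end)
    then have "homotopic_paths UNIV d e"
      using V'(3) d e unfolding relatively_simply_connected_def by simp
    then show "x = y"
      unfolding d(1) e(1) by (intro lift_end_homotopic homotopic_paths_join) (use c d in auto)
  qed
  show "open_map (subtopology (Xtilde_top b) ?S) (top_of_set V) Xtilde_proj"
    unfolding open_map_def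
  proof (intro allI impI)
    fix A assume "openin (subtopology (Xtilde_top b) ?S) A"
    then have A: "openin (Xtilde_top b) A" "A \<subseteq> ?S" using S by (simp_all add: openin_open_subtopology)
    have "\<exists>W. open W \<and> v \<in> W \<and> W \<subseteq> Xtilde_proj ` A" if v: "v \<in> Xtilde_proj ` A" for v
    proof -
      obtain x where x: "x \<in> A" "v = Xtilde_proj x" using v by blast
      have "x \<in> Xtilde b" using A(1) x(1) openin_subset topspace_Xtilde_top by blast
      then obtain e where e: "path e" "pathstart e = b" "lift_end e = x" by (rule lift_end_surj) (rule that)
      obtain W where W: "elementary W" "pathfinish e \<in> W" "sheet e W \<subseteq> A"
        by (rule sheet_neighbourhood_base[OF A(1) _ e(1,2) open_UNIV UNIV_I]) (use e x that in auto)
      have "Xtilde_proj ` sheet e W = W"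
        using W e by (intro Xtilde_proj_sheet) (auto simp: elementary_def)
      then have "W \<subseteq> Xtilde_proj ` A" using W(3) by blast
      moreover have "v = pathfinish e" using x e by (auto simp: Xtilde_proj_lift_end)
      ultimately show ?thesis using W by (auto simp: elementary_def)
    qed
    then have "open (Xtilde_proj ` A)" by (subst open_subopen) simp
    moreover have "Xtilde_proj ` A \<subseteq> V" using A(2) image by blast
    ultimately show "openin (top_of_set V) (Xtilde_proj ` A)" by (simp add: openin_open_eq V'(1))
  qed
qed

lemma covering_map_Xtilde:
  fixes b :: 'a
  shows "covering_map (Xtilde_top b) euclidean Xtilde_proj"
  unfolding covering_map_def
proof (intro conjI ballI)
  show "continuous_map (Xtilde_top b) euclidean Xtilde_proj" by (rule continuous_map_Xtilde_proj)
  have "v \<in> Xtilde_proj ` Xtilde b" for v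
  proof -
    obtain c where c: "path c" "pathstart c = b" "pathfinish c = v"
      using path_connected_poincare_space[OF poincare] unfolding path_connected_def by blast
    then show ?thesis using lift_end_in_Xtilde[OF c(1,2)] Xtilde_proj_lift_end[OF c(1)] by (metis imageI)
  qed
  then show "Xtilde_proj ` topspace (Xtilde_top b) = topspace euclidean"
    by (auto simp: topspace_Xtilde_top)
  fix x :: 'a
  obtain V where V: "elementary V" "x \<in> V"
    by (rule elementary_neighbourhood[OF poincare open_UNIV UNIV_I]) (rule that)
  define \<V> where "\<V> = {sheet c V | c. path c \<and> pathstart c = b \<and> pathfinish c \<in> V}"
  have V': "open V" "path_connected V" using V by (auto simp: elementary_def)
  have "\<Union>\<V> = {t \<in> topspace (Xtilde_top b). Xtilde_proj t \<in> V}"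
  proof (intro equalityI subsetI)
    fix t assume "t \<in> \<Union>\<V>"
    then obtain c where c: "path c" "pathstart c = b" "pathfinish c \<in> V" "t \<in> sheet c V"
      unfolding \<V>_def by blast
    then show "t \<in> {t \<in> topspace (Xtilde_top b). Xtilde_proj t \<in> V}"
      using sheet_subset_Xtilde[OF c(1,2), of V] Xtilde_proj_sheet[OF V'(2) c(1,3)] by (auto simp: topspace_Xtilde_top)
  next
    fix t assume "t \<in> {t \<in> topspace (Xtilde_top b). Xtilde_proj t \<in> V}"
    then have t: "t \<in> Xtilde b" "Xtilde_proj t \<in> V" by (auto simp: topspace_Xtilde_top)
    obtain c where c: "path c" "pathstart c = b" "lift_end c = t" by (rule lift_end_surj[OF t(1)]) (rule that)
    have "pathfinish c \<in> V" using t(2) c Xtilde_proj_lift_end[OF c(1)] by simp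
    with c show "t \<in> \<Union>\<V>" using lift_end_in_sheet[OF c(1), of V] unfolding \<V>_def by blast
  qed
  moreover have "\<forall>S\<in>\<V>. openin (Xtilde_top b) S"
    unfolding \<V>_def using openin_sheet V'(1) by blast
  moreover have "pairwise disjnt \<V>"
    unfolding pairwise_def disjnt_def \<V>_def using sheets_disjoint by blast
  moreover have "\<forall>S\<in>\<V>. homeomorphic_map (subtopology (Xtilde_top b) S) (top_of_set V) Xtilde_proj"
    unfolding \<V>_def using homeomorphic_map_sheet[OF V(1)] by blast
  ultimately show "\<exists>U. openin euclidean U \<and> x \<in> U \<and> (\<exists>\<V>. \<Union>\<V> = {t \<in> topspace (Xtilde_top b). Xtilde_proj t \<in> U} \<and>
      (\<forall>V\<in>\<V>. openin (Xtilde_top b) V) \<and> pairwise disjnt \<V> \<and>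
      (\<forall>V\<in>\<V>. homeomorphic_map (subtopology (Xtilde_top b) V) (top_of_set U) Xtilde_proj))"
    using V V'(1) by (intro exI[of _ V] conjI exI[of _ \<V>]) simp_all
qed

end

section \<open>Lifting\<close>

text \<open>The set where two lifts agree is open, because the projection is injective on a sheet, and so is
  its complement, because different sheets are disjoint.\<close>

lemma covering_map_unique_lift:
  assumes cov: "covering_map T X p" and Z: "connected_space Z"
    and f: "continuous_map Z T f" and g: "continuous_map Z T g"
    and pfg: "\<And>z. z \<in> topspace Z \<Longrightarrow> p (f z) = p (g z)"
    and z\<^sub>0: "z\<^sub>0 \<in> topspace Z" "f z\<^sub>0 = g z\<^sub>0" and z: "z \<in> topspace Z"
  shows "f z = g z"
proof -
  define A where "A = {z \<in> topspace Z. f z = g z}"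
  have loc: "\<exists>N. openin Z N \<and> z \<in> N \<and> (\<forall>w\<in>N. (f w = g w) = (f z = g z))" if z: "z \<in> topspace Z" for z
  proof -
    have fz: "f z \<in> topspace T" and gz: "g z \<in> topspace T"
      using f g z by (auto simp: continuous_map_def)
    have "p (f z) \<in> topspace X" using cov fz unfolding covering_map_def by blast
    then obtain U \<V> where U: "p (f z) \<in> U" "\<Union>\<V> = {t \<in> topspace T. p t \<in> U}"
        "\<And>V. V \<in> \<V> \<Longrightarrow> openin T V" "pairwise disjnt \<V>"
        "\<And>V. V \<in> \<V> \<Longrightarrow> homeomorphic_map (subtopology T V) (subtopology X U) p"
      using cov unfolding covering_map_def by meson
    have inj: "inj_on p V" if "V \<in> \<V>" for V
    proof -
      have "topspace (subtopology T V) = V" using openin_subset[OF U(3)[OF that]] by auto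
      then show ?thesis using homeomorphic_imp_injective_map[OF U(5)[OF that]] by simp
    qed
    obtain V where V: "V \<in> \<V>" "f z \<in> V" using U(1,2) fz by blast
    have "p (g z) \<in> U" using U(1) pfg[OF z] by simp
    then obtain V' where V': "V' \<in> \<V>" "g z \<in> V'" using U(2) gz by blast
    define N where "N = {w \<in> topspace Z. f w \<in> V} \<inter> {w \<in> topspace Z. g w \<in> V'}"
    have "openin Z N"
      unfolding N_def
      by (intro openin_Int openin_continuous_map_preimage[OF f U(3)[OF V(1)]]
          openin_continuous_map_preimage[OF g U(3)[OF V'(1)]])
    moreover have "z \<in> N" using z V V' by (simp add: N_def)
    moreover have "(f w = g w) = (f z = g z)" if w: "w \<in> N" for w
    proof (cases "V = V'")
      case True
      have "f w = g w" "f z = g z"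
        by (rule inj_onD[OF inj[OF V(1)] pfg]; use w z V V' True in \<open>simp add: N_def\<close>)+
      then show ?thesis by simp
    next
      case False
      then have "V \<inter> V' = {}" using U(4) V(1) V'(1) by (auto simp: pairwise_def disjnt_def)
      then show ?thesis using w V V' by (auto simp: N_def)
    qed
    ultimately show ?thesis by blast
  qed
  have "\<exists>N. openin Z N \<and> z \<in> N \<and> N \<subseteq> A" if z: "z \<in> A" for z
  proof -
    have zZ: "z \<in> topspace Z" and fg: "f z = g z" using z by (simp_all add: A_def)
    obtain N where N: "openin Z N" "z \<in> N" "\<forall>w\<in>N. (f w = g w) = (f z = g z)"
      using loc[OF zZ] by blast
    then show ?thesis
      using openin_subset[OF N(1)] fg by (intro exI[of _ N]) (auto simp: A_def)
  qed
  then have "openin Z A" by (subst openin_subopen) simp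
  moreover have "\<exists>N. openin Z N \<and> z \<in> N \<and> N \<subseteq> topspace Z - A" if z: "z \<in> topspace Z - A" for z
  proof -
    have zZ: "z \<in> topspace Z" and fg: "f z \<noteq> g z" using z by (simp_all add: A_def)
    obtain N where N: "openin Z N" "z \<in> N" "\<forall>w\<in>N. (f w = g w) = (f z = g z)"
      using loc[OF zZ] by blast
    then show ?thesis
      using openin_subset[OF N(1)] fg by (intro exI[of _ N]) (auto simp: A_def)
  qed
  then have "openin Z (topspace Z - A)" by (subst openin_subopen) simp
  ultimately have "A = {} \<or> A = topspace Z"
    using Z unfolding connected_space_clopen_in closedin_def by (auto simp: A_def)
  then show ?thesis using z\<^sub>0 z unfolding A_def by blast
qed

context poincare_scale
begin

text \<open>Lifts from a convex set are given by the end points of lifts along segments; near a given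
  point, this amounts to continuing one path inside a small neighbourhood.\<close>

lemma continuous_map_lift_convex:
  fixes K :: "'b::real_normed_vector \<Rightarrow> 'a"
  assumes K: "continuous_on S K" "convex S" and z\<^sub>0: "z\<^sub>0 \<in> S"
    and a: "path a" "pathstart a = b" "pathfinish a = K z\<^sub>0"
  shows "continuous_map (top_of_set S) (Xtilde_top b) (\<lambda>z. lift_end (a +++ (K \<circ> linepath z\<^sub>0 z)))"
  unfolding continuous_map_def
proof (intro conjI allI impI)
  let ?L = "\<lambda>z. lift_end (a +++ (K \<circ> linepath z\<^sub>0 z))"
  have path: "path (a +++ (K \<circ> linepath z\<^sub>0 z))" "pathstart (a +++ (K \<circ> linepath z\<^sub>0 z)) = b"
      "pathfinish (a +++ (K \<circ> linepath z\<^sub>0 z)) = K z" if "z \<in> S" for z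
    using path_comp_linepath[OF K z\<^sub>0 that] a by auto
  show "?L \<in> topspace (top_of_set S) \<rightarrow> topspace (Xtilde_top b)"
    unfolding topspace_Xtilde_top using lift_end_in_Xtilde[OF path(1,2)] by simp
  fix A assume A: "openin (Xtilde_top b) A"
  have "\<exists>N. openin (top_of_set S) N \<and> z \<in> N \<and> N \<subseteq> {z \<in> S. ?L z \<in> A}" if z: "z \<in> S" "?L z \<in> A" for z
  proof -
    let ?c = "a +++ (K \<circ> linepath z\<^sub>0 z)"
    obtain V where V: "elementary V" "K z \<in> V" "sheet ?c V \<subseteq> A"
      by (rule sheet_neighbourhood_base[OF A z(2) path(1,2)[OF z(1)] open_UNIV UNIV_I])
        (use path[OF z(1)] that in auto)
    have "openin (top_of_set S) (S \<inter> K -` V)"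
      using K(1) V(1) by (simp add: continuous_openin_preimage_gen elementary_def)
    then obtain e where e: "e > 0" "ball z e \<inter> S \<subseteq> S \<inter> K -` V"
      using V(2) z(1) unfolding openin_contains_ball by blast
    have "?L w \<in> A" if w: "w \<in> ball z e \<inter> S" for w
    proof -
      have conv: "convex (ball z e \<inter> S)" using K(2) by (simp add: convex_Int)
      have zw: "z \<in> ball z e \<inter> S" using e z by simp
      have d: "path (K \<circ> linepath z w)" "path_image (K \<circ> linepath z w) \<subseteq> K ` (ball z e \<inter> S)"
          "pathstart (K \<circ> linepath z w) = K z"
        using path_comp_linepath[OF continuous_on_subset[OF K(1)] conv zw w] by auto
      have "path_image (K \<circ> linepath z w) \<subseteq> V" using d(2) e(2) by blast
      then have "lift_end (?c +++ (K \<circ> linepath z w)) \<in> A"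
        using V(3) d path(3)[OF z(1)] unfolding sheet_def by auto
      moreover have "homotopic_paths UNIV (?c +++ (K \<circ> linepath z w)) (a +++ ((K \<circ> linepath z\<^sub>0 z) +++ (K \<circ> linepath z w)))"
        by (rule homotopic_paths_assoc_UNIV) (use a d path_comp_linepath[OF K z\<^sub>0 z(1)] in simp_all)
      moreover have "homotopic_paths UNIV (a +++ ((K \<circ> linepath z\<^sub>0 z) +++ (K \<circ> linepath z w))) (a +++ (K \<circ> linepath z\<^sub>0 w))"
        by (rule homotopic_paths_join[OF _ homotopic_paths_join_linepaths[OF K]])
          (use a z\<^sub>0 z w path_comp_linepath[OF K z\<^sub>0 z(1)] in simp_all)
      ultimately show ?thesis using lift_end_homotopic by metis
    qed
    then show ?thesis
      using e z by (intro exI[of _ "ball z e \<inter> S"]) (auto simp: openin_open)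
  qed
  then show "openin (top_of_set S) {z \<in> topspace (top_of_set S). ?L z \<in> A}"
    by (subst openin_subopen) simp
qed

lemma Xtilde_proj_lift_convex:
  fixes K :: "'b::real_normed_vector \<Rightarrow> 'a"
  assumes "continuous_on S K" "convex S" "z\<^sub>0 \<in> S" "z \<in> S" "path a" "pathfinish a = K z\<^sub>0"
  shows "Xtilde_proj (lift_end (a +++ (K \<circ> linepath z\<^sub>0 z))) = K z"
  using assms path_comp_linepath[OF assms(1-4)] by (simp add: Xtilde_proj_lift_end)

lemma lift_convex_start:
  fixes K :: "'b::real_normed_vector \<Rightarrow> 'a"
  assumes "path a" "pathfinish a = K z\<^sub>0"
  shows "lift_end (a +++ (K \<circ> linepath z\<^sub>0 z\<^sub>0)) = lift_end a"
proof -
  have "K \<circ> linepath z\<^sub>0 z\<^sub>0 = (\<lambda>_. pathfinish a)" using assms(2) by (auto simp: linepath_def algebra_simps simp flip: scaleR_left_distrib)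
  then show ?thesis using lift_end_homotopic[OF homotopic_paths_const_right[OF assms(1)]] by simp
qed

lemma pathin_lift:
  fixes c :: "real \<Rightarrow> 'a"
  assumes "path c" "path a" "pathstart a = b" "pathfinish a = pathstart c"
  defines "l \<equiv> \<lambda>t. lift_end (a +++ (c \<circ> linepath 0 t))"
  shows "pathin (Xtilde_top b) l" "l 0 = lift_end a" "l 1 = lift_end (a +++ c)"
    and "\<And>t. t \<in> {0..1} \<Longrightarrow> Xtilde_proj (l t) = c t"
proof -
  have c: "continuous_on {0..1} c" using assms(1) by (simp add: path_def)
  have a: "pathfinish a = c 0" using assms(4) by (simp add: pathstart_def)
  note conv = convex_closed_interval[of "0::real" 1, unfolded cbox_interval]
  show "pathin (Xtilde_top b) l"
    unfolding pathin_def l_def by (rule continuous_map_lift_convex[OF c conv _ assms(2,3) a]) simp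
  show "l 0 = lift_end a" unfolding l_def by (rule lift_convex_start[OF assms(2)]) (rule a)
  show "l 1 = lift_end (a +++ c)" unfolding l_def comp_linepath_0_1 ..
  show "Xtilde_proj (l t) = c t" if "t \<in> {0..1}" for t
    unfolding l_def by (rule Xtilde_proj_lift_convex[OF c conv _ that assms(2) a]) simp
qed

lemma pathin_unique_lift:
  assumes "pathin (Xtilde_top b) k" "pathin (Xtilde_top b) l" "k 0 = l 0"
    and "\<And>t. t \<in> {0..1} \<Longrightarrow> Xtilde_proj (k t) = Xtilde_proj (l t :: ('a \<times> 'a) set \<Rightarrow> 'a list set)"
    and "t \<in> {0..1}"
  shows "k t = l t"
proof (rule covering_map_unique_lift[OF covering_map_Xtilde, of "top_of_set {0..1::real}"])
  show "connected_space (top_of_set {0..1::real})" 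
    by (rule connected_space_subtopology) simp
qed (use assms in \<open>auto simp: pathin_def\<close>)

text \<open>This justifies the name: the lift of \<open>c\<close> runs through the ends of the lifts of the restrictions of
  \<open>c\<close> to initial segments.\<close>

lemma path_lift_end:
  fixes c :: "real \<Rightarrow> 'a"
  assumes c: "path c" "pathstart c = b"
  shows "path_lift b c 1 = lift_end c"
proof -
  define l where "l t = lift_end ((\<lambda>_. b) +++ (c \<circ> linepath 0 t))" for t
  have b: "path (\<lambda>_. b)" "pathstart (\<lambda>_. b) = b" "pathfinish (\<lambda>_. b) = pathstart c"
    using c(2) by (auto simp: path_def pathstart_def[of "\<lambda>_. b"] pathfinish_def)
  note L = pathin_lift[OF c(1) b, folded l_def]
  define k where "k = restrict l {0..1}"
  have k: "is_lift b c k"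
    unfolding is_lift_def
  proof (intro conjI ballI)
    show "pathin (Xtilde_top b) k"
      unfolding pathin_def by (rule continuous_map_eq[OF L(1)[unfolded pathin_def]]) (simp add: k_def)
    show "k 0 = Xtilde_base b" using L(2) by (simp add: k_def lift_end_const)
    show "Xtilde_proj (k t) = c t" if "t \<in> {0..1}" for t using L(4)[OF that] that by (simp add: k_def)
  qed
  have "path_lift b c = k"
    unfolding path_lift_def
  proof (rule the_equality)
    show "k \<in> extensional {0..1} \<and> is_lift b c k" using k by (simp add: k_def)
    fix m assume m: "m \<in> extensional {0..1} \<and> is_lift b c m"
    show "m = k"
    proof (rule extensionalityI[of _ "{0..1}"])
      fix t :: real assume t: "t \<in> {0..1}"
      show "m t = k t"
        by (rule pathin_unique_lift[OF _ _ _ _ t, of b]) (use m k in \<open>simp_all add: is_lift_def\<close>)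
    qed (use m in \<open>simp_all add: k_def\<close>)
  qed
  moreover have "l 1 = lift_end c"
    using L(3) lift_end_homotopic[OF homotopic_paths_const_left[OF c(1)]] c(2) by simp
  ultimately show ?thesis by (simp add: k_def)
qed

section \<open>Simple connectedness\<close>

lemma path_connected_space_Xtilde:
  fixes b :: 'a
  shows "path_connected_space (Xtilde_top b)"
  unfolding path_connected_space_def topspace_Xtilde_top
proof (intro ballI)
  fix x y assume x: "x \<in> Xtilde b" and y: "y \<in> Xtilde b"
  obtain a where a: "path a" "pathstart a = b" "lift_end a = x" by (rule lift_end_surj[OF x]) (rule that)
  obtain h where h: "path h" "pathstart h = b" "lift_end h = y" by (rule lift_end_surj[OF y]) (rule that)
  let ?l = "\<lambda>t. lift_end (a +++ ((reversepath a +++ h) \<circ> linepath 0 t))"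
  have "path (reversepath a +++ h)" "pathfinish a = pathstart (reversepath a +++ h)"
    using a h by auto
  note L = pathin_lift[OF this(1) a(1,2) this(2)]
  have "lift_end (a +++ (reversepath a +++ h)) = lift_end h"
    using a h by (intro lift_end_homotopic homotopic_paths_cancel_reverse) auto
  with L a h show "\<exists>g. pathin (Xtilde_top b) g \<and> g 0 = x \<and> g 1 = y"
    by (intro exI[of _ ?l]) simp
qed

text \<open>A loop in the inverse limit is the lift of its projection. Since it closes up, the projection
  is null-homotopic, and the null-homotopy lifts; by uniqueness of lifts the lifted square restricts
  to the given loop on one side and is constant on the others.\<close>

lemma simply_connected_space_Xtilde:
  fixes b :: 'a
  shows "simply_connected_space (Xtilde_top b)"
  unfolding simply_connected_space_def
proof (intro conjI allI impI path_connected_space_Xtilde)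
  fix l assume "pathin (Xtilde_top b) l \<and> l 0 = l 1"
  then have l: "pathin (Xtilde_top b) l" "l 0 = l 1" by auto
  have l0: "l 0 \<in> Xtilde b" using path_start_in_topspace[OF l(1)] by (simp add: topspace_Xtilde_top)
  obtain a where a: "path a" "pathstart a = b" "lift_end a = l 0" by (rule lift_end_surj[OF l0]) (rule that)
  define c where "c = Xtilde_proj \<circ> l"
  have "pathin euclidean c"
    unfolding c_def by (rule pathin_compose[OF l(1) continuous_map_Xtilde_proj])
  then have c: "path c" by (simp add: pathin_def path_def)
  have ac: "pathfinish a = c 0" using Xtilde_proj_lift_end[OF a(1)] a(3) by (simp add: c_def)
  then have ac': "pathfinish a = pathstart c" by (simp add: pathstart_def)
  have c01: "c 1 = c 0" using l(2) by (simp add: c_def)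
  note M = pathin_lift[OF c a(1,2) ac']
  have "l 1 = lift_end (a +++ (c \<circ> linepath 0 1))"
    by (rule pathin_unique_lift[OF l(1) M(1)]) (use M(2,4) a(3) in \<open>simp_all add: c_def\<close>)
  then have "lift_end (a +++ c) = lift_end a" using M(3) a(3) l(2) by simp
  then have "homotopic_paths UNIV (a +++ c) a"
    using lift_end_eq_iff[of "a +++ c" a] a(1) c ac' by simp
  then have "homotopic_paths UNIV (a +++ c) (a +++ (\<lambda>_. pathfinish a))"
    by (rule homotopic_paths_trans[OF _ homotopic_paths_sym[OF homotopic_paths_const_right[OF a(1)]]])
  then have null: "homotopic_paths UNIV c (\<lambda>_. pathfinish a)"
    by (rule homotopic_paths_cancel_left)
      (use a(1) c ac' in \<open>simp_all add: path_def pathstart_def[of "\<lambda>_. pathfinish a"] pathstart_def[of "\<lambda>_. pathstart c"]\<close>)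
  let ?I = "{0..1::real}"
  obtain h :: "real \<times> real \<Rightarrow> 'a" where h: "continuous_on (?I \<times> ?I) h"
      "\<forall>x\<in>?I. h (0, x) = c x" "\<forall>x\<in>?I. h (1, x) = pathfinish a"
      "\<forall>t\<in>?I. pathstart (h \<circ> Pair t) = pathstart c \<and> pathfinish (h \<circ> Pair t) = pathfinish c"
    using null unfolding homotopic_paths by (elim exE conjE, intro that) assumption+
  have h0: "h (t, 0) = c 0" and h1: "h (t, 1) = c 0" if "t \<in> ?I" for t
    using h(4) that c01 by (auto simp: pathstart_def pathfinish_def)
  define G where "G z = lift_end (a +++ (h \<circ> linepath (0, 0) z))" for z
  have conv: "convex (?I \<times> ?I)" by (intro convex_Times) auto
  have z0: "(0, 0) \<in> ?I \<times> ?I" by simp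
  have ah: "pathfinish a = h (0, 0)" using h0[of 0] ac by simp
  have G: "continuous_map (top_of_set (?I \<times> ?I)) (Xtilde_top b) G"
    unfolding G_def by (rule continuous_map_lift_convex[OF h(1) conv z0 a(1,2) ah])
  have proj_G: "Xtilde_proj (G z) = h z" if "z \<in> ?I \<times> ?I" for z
    unfolding G_def by (rule Xtilde_proj_lift_convex[OF h(1) conv z0 that a(1) ah])
  have G00: "G (0, 0) = l 0"
    unfolding G_def a(3)[symmetric] by (rule lift_convex_start[OF a(1)]) (rule ah)
  have side: "pathin (Xtilde_top b) (G \<circ> e)" if "continuous_on ?I e" "e ` ?I \<subseteq> ?I \<times> ?I" for e
    unfolding pathin_def
    by (rule continuous_map_compose[OF _ G]) (use that in auto)
  have const: "pathin (Xtilde_top b) (\<lambda>_. l 0)" using l0 by (simp add: topspace_Xtilde_top)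
  have bottom: "G (t, 0) = l 0" if "t \<in> ?I" for t
  proof -
    have "pathin (Xtilde_top b) (G \<circ> (\<lambda>t. (t, 0)))"
      by (rule side) (auto intro!: continuous_intros)
    from pathin_unique_lift[OF this const _ _ that] show ?thesis
      using G00 proj_G h0 by (simp add: c_def)
  qed
  have left: "G (0, t) = l t" if "t \<in> ?I" for t
  proof -
    have "pathin (Xtilde_top b) (G \<circ> (\<lambda>t. (0, t)))"
      by (rule side) (auto intro!: continuous_intros)
    from pathin_unique_lift[OF this l(1) _ _ that] show ?thesis
      using G00 proj_G h(2) by (simp add: c_def)
  qed
  have right: "G (1, t) = l 0" if "t \<in> ?I" for t
  proof -
    have "pathin (Xtilde_top b) (G \<circ> (\<lambda>t. (1, t)))"
      by (rule side) (auto intro!: continuous_intros)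
    from pathin_unique_lift[OF this const _ _ that] show ?thesis
      using bottom[of 1] proj_G h(3) ac by (simp add: c_def)
  qed
  have top: "G (t, 1) = l 0" if "t \<in> ?I" for t
  proof -
    have "pathin (Xtilde_top b) (G \<circ> (\<lambda>t. (t, 1)))"
      by (rule side) (auto intro!: continuous_intros)
    from pathin_unique_lift[OF this const _ _ that] show ?thesis
      using left[of 1] l(2) proj_G h1 by (simp add: c_def)
  qed
  show "homotopic_with (\<lambda>k. k 0 = l 0 \<and> k 1 = l 1) (top_of_set ?I) (Xtilde_top b) l (\<lambda>_. l 0)"
  proof (subst homotopic_with)
    show "\<exists>k. continuous_map (prod_topology (top_of_set ?I) (top_of_set ?I)) (Xtilde_top b) k \<and>
        (\<forall>x\<in>topspace (top_of_set ?I). k (0, x) = l x) \<and>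
        (\<forall>x\<in>topspace (top_of_set ?I). k (1, x) = l 0) \<and>
        (\<forall>t\<in>?I. k (t, 0) = l 0 \<and> k (t, 1) = l 1)"
      using G left right bottom top l(2)
      by (intro exI[of _ G]) (simp add: subtopology_Times[symmetric] flip: euclidean_product_topology)
  qed auto
qed

section \<open>The fundamental group\<close>

lemma path_class_eq_iff:
  assumes "path c"
  shows "path_class c = path_class d \<longleftrightarrow> homotopic_paths UNIV c d"
proof
  assume "path_class c = path_class d"
  moreover have "c \<in> path_class c" using assms by (simp add: path_class_def)
  ultimately show "homotopic_paths UNIV c d" by (simp add: path_class_def homotopic_paths_sym)
next
  assume "homotopic_paths UNIV c d"
  then show "path_class c = path_class d"
    unfolding path_class_def by (blast intro: homotopic_paths_trans homotopic_paths_sym)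
qed

lemma pi1_mult:
  assumes "path c" "path d" "pathfinish c = pathstart d"
  shows "path_class c \<otimes>\<^bsub>pi1 b\<^esub> path_class d = path_class (c +++ d)"
proof -
  have "path_class (c' +++ d') = path_class (c +++ d)" if "c' \<in> path_class c" "d' \<in> path_class d" for c' d'
  proof -
    have "homotopic_paths UNIV (c +++ d) (c' +++ d')"
      using that assms(3) by (intro homotopic_paths_join) (auto simp: path_class_def)
    then show ?thesis using path_class_eq_iff homotopic_paths_imp_path by metis
  qed
  moreover have "c \<in> path_class c" "d \<in> path_class d" using assms by (simp_all add: path_class_def)
  ultimately have "(\<Union>c'\<in>path_class c. \<Union>d'\<in>path_class d. path_class (c' +++ d')) = path_class (c +++ d)"
    by blast
  then show ?thesis by (simp add: pi1_def)
qed

lemma delta_mult: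
  assumes "is_chain E p q \<alpha>" "is_chain E q r \<beta>"
  shows "chain_class E \<alpha> \<otimes>\<^bsub>delta b E\<^esub> chain_class E \<beta> = chain_class E (\<alpha> @ tl \<beta>)"
proof -
  have "chain_class E (\<alpha>' @ tl \<beta>') = chain_class E (\<alpha> @ tl \<beta>)"
    if "\<alpha>' \<in> chain_class E \<alpha>" "\<beta>' \<in> chain_class E \<beta>" for \<alpha>' \<beta>'
  proof -
    have h: "chain_homotopic E \<alpha> \<alpha>'" "chain_homotopic E \<beta> \<beta>'" using that by (simp_all add: chain_class_def)
    have \<alpha>': "is_chain E p q \<alpha>'" by (rule chain_homotopic_preserves[OF h(1) assms(1)])
    have "chain_homotopic E (\<alpha> @ tl \<beta>) (\<alpha>' @ tl \<beta>)"
      by (rule chain_homotopic_join_left[OF h(1) assms])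
    also have "chain_homotopic E (\<alpha>' @ tl \<beta>) (\<alpha>' @ tl \<beta>')"
      by (rule chain_homotopic_join_right[OF h(2) assms(2) \<alpha>'])
    finally show ?thesis unfolding chain_class_eq_iff by (rule equivclp_sym)
  qed
  moreover have "\<alpha> \<in> chain_class E \<alpha>" "\<beta> \<in> chain_class E \<beta>" by (simp_all add: chain_class_def)
  ultimately have "(\<Union>\<alpha>'\<in>chain_class E \<alpha>. \<Union>\<beta>'\<in>chain_class E \<beta>. chain_class E (\<alpha>' @ tl \<beta>')) = chain_class E (\<alpha> @ tl \<beta>)"
    by blast
  then show ?thesis by (simp add: delta_def)
qed

lemma lift_end_join:
  fixes c d :: "real \<Rightarrow> 'a"
  assumes c: "path c" and d: "path d" and cd: "pathfinish c = pathstart d"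
  shows "lift_end (c +++ d) = lift_end c \<otimes>\<^bsub>delta1 b\<^esub> lift_end d"
proof
  fix E :: "('a \<times> 'a) set"
  show "lift_end (c +++ d) E = (lift_end c \<otimes>\<^bsub>delta1 b\<^esub> lift_end d) E"
  proof (cases "E \<in> entourages")
    case True
    obtain ts where ts: "fine_partition E c ts" by (rule fine_partition_exists[OF c True])
    obtain us where us: "fine_partition E d us" by (rule fine_partition_exists[OF d True])
    have cd': "c 1 = d 0" using cd by (simp add: pathstart_def pathfinish_def)
    obtain vs where vs: "fine_partition E (c +++ d) vs" "map (c +++ d) vs = map c ts @ tl (map d us)"
      by (rule fine_partition_join[OF ts us cd']) (rule that)
    show ?thesis
      using delta_mult[OF fine_partition_chain[OF ts], of "d 1" "map d us" b] fine_partition_chain[OF us] True cd'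
      by (simp add: delta1_def lift_end_eq[OF True ts] lift_end_eq[OF True us] lift_end_eq[OF True vs(1)] vs(2))
  qed (simp add: lift_end_def delta1_def)
qed

lemma lift_end_in_delta1:
  fixes c :: "real \<Rightarrow> 'a"
  assumes c: "path c" "pathstart c = b" "pathfinish c = b"
  shows "lift_end c \<in> carrier (delta1 b)"
proof -
  have "lift_end c E \<in> carrier (delta b E)" if E: "E \<in> entourages" for E
  proof -
    obtain ts where ts: "fine_partition E c ts" by (rule fine_partition_exists[OF c(1) E])
    show ?thesis
      using lift_end_eq[OF E ts] fine_partition_chain[OF ts] c
      by (auto simp: delta_def pathstart_def pathfinish_def)
  qed
  then show ?thesis
    using lift_end_in_Xtilde[OF c(1,2)] by (simp add: delta1_def Xtilde_def PiE_def)
qed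

lemma delta1_in_Xtilde:
  assumes "x \<in> carrier (delta1 b)"
  shows "x \<in> Xtilde b" "Xtilde_proj x = b"
proof -
  have sub: "carrier (delta b E) \<subseteq> chain_space b E" for E
    by (auto simp: delta_def chain_space_def)
  have x: "x \<in> (\<Pi>\<^sub>E E\<in>entourages. carrier (delta b E))"
    "\<forall>E\<in>entourages. \<forall>F\<in>entourages. F \<subseteq> E \<longrightarrow> bonding E (x F) = x E"
    using assms by (simp_all add: delta1_def)
  then show "x \<in> Xtilde b"
    unfolding Xtilde_def using PiE_mono[of entourages "\<lambda>E. carrier (delta b E)" "chain_space b"] sub by blast
  have "x UNIV \<in> carrier (delta b UNIV)" using x(1) entourage_UNIV by (rule PiE_mem)
  then obtain \<alpha> where "x UNIV = chain_class UNIV \<alpha>" "is_chain UNIV b b \<alpha>"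
    by (auto simp: delta_def)
  then show "Xtilde_proj x = b" by (simp add: Xtilde_proj_def last_chain_class)
qed

lemma lambda_map_path_class:
  fixes c :: "real \<Rightarrow> 'a"
  assumes c: "path c" "pathstart c = b"
  shows "lambda_map b (path_class c) = lift_end c"
proof -
  have "path_lift b d 1 = lift_end c" if "d \<in> path_class c" for d
  proof -
    have cd: "homotopic_paths UNIV c d" using that by (simp add: path_class_def)
    then have "path d" "pathstart d = b"
      using c homotopic_paths_imp_path[OF cd] homotopic_paths_imp_pathstart[OF cd] by simp_all
    then show ?thesis using path_lift_end lift_end_homotopic[OF cd] by simp
  qed
  moreover have "c \<in> path_class c" using c by (simp add: path_class_def)
  ultimately have "(\<lambda>d. path_lift b d 1) ` path_class c = {lift_end c}"
    by (intro equalityI subsetI) (auto intro: image_eqI[of _ _ c])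
  then show ?thesis by (simp add: lambda_map_def)
qed

lemma lambda_map_iso:
  fixes b :: 'a
  shows "lambda_map b \<in> iso (pi1 b) (delta1 b)"
proof -
  have pi1_E: "\<exists>c. P = path_class c \<and> path c \<and> pathstart c = b \<and> pathfinish c = b"
    if "P \<in> carrier (pi1 b)" for P
    using that by (auto simp: pi1_def)
  have hom: "lambda_map b \<in> hom (pi1 b) (delta1 b)"
  proof (rule homI)
    fix P assume "P \<in> carrier (pi1 b)"
    then obtain c where c: "P = path_class c" "path c" "pathstart c = b" "pathfinish c = b" using pi1_E by blast
    then show "lambda_map b P \<in> carrier (delta1 b)"
      by (simp add: lambda_map_path_class lift_end_in_delta1)
  next
    fix P Q assume "P \<in> carrier (pi1 b)" "Q \<in> carrier (pi1 b)"
    then obtain c d where c: "P = path_class c" "path c" "pathstart c = b" "pathfinish c = b"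
      and d: "Q = path_class d" "path d" "pathstart d = b" "pathfinish d = b" using pi1_E by meson
    then show "lambda_map b (P \<otimes>\<^bsub>pi1 b\<^esub> Q) = lambda_map b P \<otimes>\<^bsub>delta1 b\<^esub> lambda_map b Q"
      by (simp add: pi1_mult lambda_map_path_class lift_end_join)
  qed
  have "inj_on (lambda_map b) (carrier (pi1 b))"
  proof (rule inj_onI)
    fix P Q assume "P \<in> carrier (pi1 b)" "Q \<in> carrier (pi1 b)" and eq: "lambda_map b P = lambda_map b Q"
    then obtain c d where c: "P = path_class c" "path c" "pathstart c = b"
      and d: "Q = path_class d" "path d" "pathstart d = b" using pi1_E by meson
    with eq have "lift_end c = lift_end d" by (simp add: lambda_map_path_class)
    then show "P = Q" using c d by (simp add: lift_end_eq_iff path_class_eq_iff)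
  qed
  moreover have "carrier (delta1 b) \<subseteq> lambda_map b ` carrier (pi1 b)"
  proof
    fix x assume x: "x \<in> carrier (delta1 b)"
    obtain c where c: "path c" "pathstart c = b" "lift_end c = x"
      by (rule lift_end_surj[OF delta1_in_Xtilde(1)[OF x]]) (rule that)
    have "pathfinish c = b" using delta1_in_Xtilde(2)[OF x] Xtilde_proj_lift_end[OF c(1)] c(3) by simp
    then have "path_class c \<in> carrier (pi1 b)" using c by (auto simp: pi1_def)
    then show "x \<in> lambda_map b ` carrier (pi1 b)"
      using lambda_map_path_class[OF c(1,2)] c(3) by (metis imageI)
  qed
  moreover have "lambda_map b ` carrier (pi1 b) \<subseteq> carrier (delta1 b)"
    using hom by (auto simp: hom_def)
  ultimately show ?thesis
    using hom by (auto simp: iso_def bij_betw_def)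
qed

end

theorem corollary86:
  fixes b :: "'a::{uniform_space, t2_space}"
  assumes "compact (UNIV :: 'a set)"
    and "poincare_space (UNIV :: 'a set)"
  shows "universal_covering_map (Xtilde_top b) euclidean Xtilde_proj
         \<and> lambda_map b \<in> iso (pi1 b) (delta1 b)"
proof -
  obtain F D :: "('a \<times> 'a) set" where "poincare_scale F D"
    by (rule poincare_scale_exists[OF assms]) (rule that)
  then interpret poincare_scale F D .
  show ?thesis
    unfolding universal_covering_map_def
    using covering_map_Xtilde simply_connected_space_Xtilde lambda_map_iso by blast
qed

end
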